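(* Let $J\subseteq I\subseteq S$ be such that the normalizer $N_W(W_J)$ is contained in $W_I$. Let $f:\overline H_I\to\mathbb Z[\mathbf q^{\pm1}]$ be a $\mathbb Z[\mathbf q^{\pm1}]$-linear map, also viewed as a function on $H_I$ vanishing on $[H_I,H_I]$. Assume furthermore that for any $J'\subset I$ that does not contain a $W_I$-conjugate of $J$, we have $f(T_w)=0$ for every $w\in W_{J'}$. For $h\in H$ put $$\mathrm{Ind}_I^S(f)(h)=\sum_{v_1\in W^I,\ v_2\in W_I}f(T_{v_2})\,\mathbf q^{-\ell(v_1)-\ell(v_2)}\,\tau\bigl(T_{(v_1v_2)^{-1}}\,h\,T_{v_1}\bigr).$$ Then: (1) For any $h\in H$ the sum defining $\mathrm{Ind}_I^S(f)(h)$ has only finitely many non-zero terms; thus $\mathrm{Ind}_I^S(f):H\to\mathbb Z[\mathbf q^{\pm1}]$ is well defined. (2) $\mathrm{Ind}_I^S(f)$ vanishes on $[H,H]$, hence induces a linear map $\overline H\to\mathbb Z[\mathbf q^{\pm1}]$, still denoted $\mathrm{Ind}_I^S(f)$. (3) If, in addition, for every subset $K\subseteq S$ that is $W$-conjugate to $J$ we have $N_W(W_K)\subseteq W_I$, then the restriction of $\mathrm{Ind}_I^S(f)$ to $H_I$ coincides with $f$. (4) If $K\subseteq S$ is such that no subset of $K$ is $W$-conjugate to $J$, then $\mathrm{Ind}_I^S(f)(T_w)=0$ for all $w\in W_K$. (5) For any $\mathcal O\in\mathrm{Cl}(W)$, $$\mathrm{Ind}_I^S(f)(T_{\mathcal O})\equiv\sum_{\mathcal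 O'\in\mathrm{Cl}(W_I),\ \mathcal O'\subseteq\mathcal O}c_{\mathcal O'}f(T_{\mathcal O'})\pmod{\mathbf q-1}$$ for some constants $c_{\mathcal O'}\in\mathbb Z_{>0}$ depending on $\mathcal O'\subseteq\mathcal O$.
   Context: $(W,S)$ is the Weyl group of a split Kac--Moody group, i.e. a crystallographic Coxeter system ($S$ finite, orders of products of two distinct simple reflections in $\{2,3,4,6,\infty\}$), with length $\ell$. For $I\subseteq S$, $W_I$ is the subgroup generated by $I$ and $W^I=\{w\in W\mid ws>w\ \forall s\in I\}$ the set of minimal length representatives of $W/W_I$. Two subsets $K,K'$ of $S$ are $W$-conjugate (resp. $W_I$-conjugate) if $K'=wKw^{-1}$ for some $w\in W$ (resp. $w\in W_I$). $H$ is the $\mathbb Z[\mathbf q^{\pm1}]$-algebra with generators $T_s$ ($s\in S$), relations $(T_s+1)(T_s-\mathbf q)=0$ and the braid relations, with standard basis $\{T_w\}_{w\in W}$. $H_I$ is the Hecke algebra of $(W_I,I)$, identified with the span of $T_w$, $w\in W_I$. $[H,H]$ is the span of commutators, $\overline H=H/[H,H]$, and similarly $\overline H_I=H_I/[H_I,H_I]$. For a conjugacy class $\mathcal O$ in $\mathrm{Cl}(W)$, $T_{\mathcal O}\in\overline H$ is the image of $T_w$ for any $w\in\mathcal O$ of minimal length (independent of $w$); similarly for $\mathrm{Cl}(W_I)$ and $\overline H_I$. $\tau:H\to\mathbb Z[\mathbf q^{\pm1}]$ is the linear map with $\tau(T_1)=1$, $\tau(T_w)=0$ for $w\ne1$.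 *)

theory Defs
  imports
    "HOL-Algebra.Multiplicative_Group"
    "HOL-Algebra.Generated_Groups"
    "HOL-Algebra.Group_Action"
    "HOL-Library.Poly_Mapping"
begin

section \<open>Coxeter systems\<close>

definition word_prod :: "('w, 'm) monoid_scheme \<Rightarrow> 'w list \<Rightarrow> 'w" where
  "word_prod W xs = foldr (\<otimes>\<^bsub>W\<^esub>) xs \<one>\<^bsub>W\<^esub>"

text \<open>
  The congruence on the free monoid of words over \<open>S\<close> generated by the relations
  \<open>(s t)^m(s,t) = 1\<close>, where \<open>m(s,t)\<close> is the order of \<open>s t\<close> in \<open>W\<close>.  Pairs with \<open>st\<close> of infinite
  order have \<open>ord = 0\<close> and contribute only the trivial relation; \<open>s = t\<close> gives \<open>s s = 1\<close>
  (because of which the monoid and the group presented by these relations coincide).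
\<close>
inductive coxeter_equiv :: "('w, 'm) monoid_scheme \<Rightarrow> 'w set \<Rightarrow> 'w list \<Rightarrow> 'w list \<Rightarrow> bool"
  for W (structure) and S where
  refl: "xs \<in> lists S \<Longrightarrow> coxeter_equiv W S xs xs"
| sym: "coxeter_equiv W S xs ys \<Longrightarrow> coxeter_equiv W S ys xs"
| trans: "coxeter_equiv W S xs ys \<Longrightarrow> coxeter_equiv W S ys zs \<Longrightarrow> coxeter_equiv W S xs zs"
| relation: "\<lbrakk>s \<in> S; t \<in> S; xs \<in> lists S; ys \<in> lists S\<rbrakk> \<Longrightarrow>
    coxeter_equiv W S (xs @ concat (replicate (group.ord W (s \<otimes> t)) [s, t]) @ ys) (xs @ ys)"

locale crystallographic_coxeter_system = group W for W (structure) +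
  fixes S :: "'a set"
  assumes finite_S: "finite S"
    and S_subset: "S \<subseteq> carrier W"
    and generated: "generate W S = carrier W"
    and not_one: "s \<in> S \<Longrightarrow> s \<noteq> \<one>"
    and involution: "s \<in> S \<Longrightarrow> s \<otimes> s = \<one>"
    and presentation: "\<lbrakk>xs \<in> lists S; ys \<in> lists S; word_prod W xs = word_prod W ys\<rbrakk> \<Longrightarrow>
      coxeter_equiv W S xs ys"
    \<comment> \<open>order \<open>0\<close> encodes infinite order\<close>
    and crystallographic: "\<lbrakk>s \<in> S; t \<in> S; s \<noteq> t\<rbrakk> \<Longrightarrow> ord (s \<otimes> t) \<in> {0, 2, 3, 4, 6}"

definition cox_length :: "('w, 'm) monoid_scheme \<Rightarrow> 'w set \<Rightarrow> 'w \<Rightarrow> nat" where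
  "cox_length W S w = (LEAST n. \<exists>xs \<in> lists S. length xs = n \<and> word_prod W xs = w)"

text \<open>\<open>W\<^sup>I\<close>: for \<open>s \<in> S\<close>, the relation \<open>w s > w\<close> in the Bruhat order means that the length goes up.\<close>
definition min_coset_reps :: "('w, 'm) monoid_scheme \<Rightarrow> 'w set \<Rightarrow> 'w set \<Rightarrow> 'w set" where
  "min_coset_reps W S I =
    {w \<in> carrier W. \<forall>s\<in>I. cox_length W S (w \<otimes>\<^bsub>W\<^esub> s) > cox_length W S w}"

definition conj_under :: "('w, 'm) monoid_scheme \<Rightarrow> 'w set \<Rightarrow> 'w set \<Rightarrow> 'w set \<Rightarrow> bool" where
  "conj_under W H K K' \<longleftrightarrow> (\<exists>g\<in>H. K' = g <#\<^bsub>W\<^esub> K #>\<^bsub>W\<^esub> inv\<^bsub>W\<^esub> g)"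

text \<open>The conjugacy classes \<open>Cl(H)\<close> of a subgroup \<open>H\<close> of \<open>W\<close> (under conjugation by \<open>H\<close>).\<close>
definition conj_classes :: "('w, 'm) monoid_scheme \<Rightarrow> 'w set \<Rightarrow> 'w set set" where
  "conj_classes W H = (\<lambda>x. {g \<otimes>\<^bsub>W\<^esub> x \<otimes>\<^bsub>W\<^esub> inv\<^bsub>W\<^esub> g | g. g \<in> H}) ` H"

text \<open>For a parabolic subgroup \<open>W\<^sub>I\<close> the length function of \<open>(W\<^sub>I, I)\<close> is the restriction
  of the one of \<open>(W, S)\<close>, so this is used for classes of both \<open>W\<close> and \<open>W\<^sub>I\<close>.\<close>
definition min_length_elts :: "('w, 'm) monoid_scheme \<Rightarrow> 'w set \<Rightarrow> 'w set \<Rightarrow> 'w set" where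
  "min_length_elts W S C = {w \<in> C. \<forall>v\<in>C. cox_length W S w \<le> cox_length W S v}"


section \<open>Iwahori--Hecke algebras\<close>

text \<open>The Laurent polynomial ring \<open>\<int>[q, q\<^sup>-\<^sup>1]\<close> as the group ring of \<open>\<int>\<close> over \<open>\<int>\<close>;
  \<open>qpow k\<close> is \<open>q\<close> to the power \<open>k\<close>.\<close>
type_synonym laurent = "int \<Rightarrow>\<^sub>0 int"

definition qpow :: "int \<Rightarrow> laurent" where
  "qpow k = Poly_Mapping.single k 1"

definition alternating :: "'w \<Rightarrow> 'w \<Rightarrow> nat \<Rightarrow> 'w list" where
  "alternating s t n = map (\<lambda>i. if even i then s else t) [0..<n]"

text \<open>
  The unital associative \<open>\<int>[q, q\<^sup>-\<^sup>1]\<close>-algebra \<open>H\<close> is the whole type \<open>'h\<close>, with scalar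
  multiplication \<open>scale\<close>.  The quadratic and braid relations imply that the products \<open>T\<^sub>w\<close> along
  reduced words span the subalgebra generated by the \<open>T\<^sub>s\<close>; that they form a basis therefore says
  that the \<open>T\<^sub>s\<close> generate \<open>H\<close> and that these relations are defining.  So \<open>H\<close> is determined up
  to unique isomorphism preserving the \<open>T\<^sub>s\<close>.
\<close>
locale hecke_algebra = crystallographic_coxeter_system W S for W (structure) and S :: "'a set" +
  fixes scale :: "laurent \<Rightarrow> 'h::ring_1 \<Rightarrow> 'h"
    and T :: "'a \<Rightarrow> 'h"
  assumes scale_module: "Modules.module scale"
    and scale_mult_left: "scale a x * y = scale a (x * y)"
    and scale_mult_right: "x * scale a y = scale a (x * y)"
    and quadratic: "s \<in> S \<Longrightarrow> (T s + 1) * (T s - scale (qpow 1) 1) = 0"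
    and braid: "\<lbrakk>s \<in> S; t \<in> S; s \<noteq> t; n = ord (s \<otimes> t); n \<noteq> 0\<rbrakk> \<Longrightarrow>
      prod_list (map T (alternating s t n)) = prod_list (map T (alternating t s n))"
    and T_reduced: "\<lbrakk>xs \<in> lists S; length xs = cox_length W S (word_prod W xs)\<rbrakk> \<Longrightarrow>
      T (word_prod W xs) = prod_list (map T xs)"
    and T_inj: "inj_on T (carrier W)"
    and T_independent: "\<not> module.dependent scale (T ` carrier W)"
    and T_spanning: "module.span scale (T ` carrier W) = UNIV"

text \<open>\<open>H\<^sub>I\<close>, as a subalgebra of \<open>H\<close>\<close>
definition parabolic_hecke ::
  "('w, 'm) monoid_scheme \<Rightarrow> (laurent \<Rightarrow> 'h::ring_1 \<Rightarrow> 'h) \<Rightarrow> ('w \<Rightarrow> 'h) \<Rightarrow> 'w set \<Rightarrow> 'h set" where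
  "parabolic_hecke W scale T I = module.span scale (T ` generate W I)"

text \<open>\<open>[A, A]\<close>\<close>
definition commutator_span :: "(laurent \<Rightarrow> 'h::ring_1 \<Rightarrow> 'h) \<Rightarrow> 'h set \<Rightarrow> 'h set" where
  "commutator_span scale A = module.span scale {x * y - y * x | x y. x \<in> A \<and> y \<in> A}"

text \<open>Linear maps \<open>A/[A,A] \<rightarrow> \<int>[q, q\<^sup>-\<^sup>1]\<close>, as linear functions on the subalgebra \<open>A\<close>
  vanishing on \<open>[A,A]\<close>; the values outside \<open>A\<close> are irrelevant.\<close>
definition cocenter_form ::
  "(laurent \<Rightarrow> 'h::ring_1 \<Rightarrow> 'h) \<Rightarrow> 'h set \<Rightarrow> ('h \<Rightarrow> laurent) \<Rightarrow> bool" where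
  "cocenter_form scale A f \<longleftrightarrow>
     (\<forall>x\<in>A. \<forall>y\<in>A. f (x + y) = f x + f y) \<and>
     (\<forall>a. \<forall>x\<in>A. f (scale a x) = a * f x) \<and>
     (\<forall>x\<in>commutator_span scale A. f x = 0)"

definition is_tau ::
  "('w, 'm) monoid_scheme \<Rightarrow> (laurent \<Rightarrow> 'h::ring_1 \<Rightarrow> 'h) \<Rightarrow> ('w \<Rightarrow> 'h) \<Rightarrow> ('h \<Rightarrow> laurent) \<Rightarrow> bool"
  where
  "is_tau W scale T \<tau> \<longleftrightarrow>
     Modules.module_hom scale (*) \<tau> \<and>
     \<tau> (T \<one>\<^bsub>W\<^esub>) = 1 \<and> (\<forall>w\<in>carrier W. w \<noteq> \<one>\<^bsub>W\<^esub> \<longrightarrow> \<tau> (T w) = 0)"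

definition ind_term ::
  "('w, 'm) monoid_scheme \<Rightarrow> 'w set \<Rightarrow> ('w \<Rightarrow> 'h::ring_1) \<Rightarrow> ('h \<Rightarrow> laurent) \<Rightarrow>
    ('h \<Rightarrow> laurent) \<Rightarrow> 'h \<Rightarrow> 'w \<Rightarrow> 'w \<Rightarrow> laurent" where
  "ind_term W S T \<tau> f h v1 v2 =
     f (T v2) * qpow (- int (cox_length W S v1) - int (cox_length W S v2)) *
     \<tau> (T (inv\<^bsub>W\<^esub> (v1 \<otimes>\<^bsub>W\<^esub> v2)) * h * T v1)"

definition ind_support ::
  "('w, 'm) monoid_scheme \<Rightarrow> 'w set \<Rightarrow> ('w \<Rightarrow> 'h::ring_1) \<Rightarrow> ('h \<Rightarrow> laurent) \<Rightarrow>
    'w set \<Rightarrow> ('h \<Rightarrow> laurent) \<Rightarrow> 'h \<Rightarrow> ('w \<times> 'w) set" where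
  "ind_support W S T \<tau> I f h =
     {(v1, v2). v1 \<in> min_coset_reps W S I \<and> v2 \<in> generate W I \<and> ind_term W S T \<tau> f h v1 v2 \<noteq> 0}"

text \<open>The sum over all of \<open>W\<^sup>I \<times> W\<^sub>I\<close>, taken over its non-zero terms; meaningful
  when there are only finitely many of them.\<close>
definition ind ::
  "('w, 'm) monoid_scheme \<Rightarrow> 'w set \<Rightarrow> ('w \<Rightarrow> 'h::ring_1) \<Rightarrow> ('h \<Rightarrow> laurent) \<Rightarrow>
    'w set \<Rightarrow> ('h \<Rightarrow> laurent) \<Rightarrow> 'h \<Rightarrow> laurent" where
  "ind W S T \<tau> I f h = (\<Sum>(v1, v2)\<in>ind_support W S T \<tau> I f h. ind_term W S T \<tau> f h v1 v2)"

end

theory Submission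
  imports Defs
begin

text \<open>
  For \<open>v \<in> W\<^sup>I\<close> and \<open>x \<in> W\<^sub>I\<close>, removing the first letter of a reduced word of \<open>x\<close> shortens
  \<open>v x v\<^sup>-\<^sup>1\<close>.  So if \<open>\<ell> (v x v\<^sup>-\<^sup>1)\<close> is bounded, then so is \<open>\<ell> (v s v\<^sup>-\<^sup>1)\<close> for every \<open>s\<close> in the
  support of \<open>x\<close>.  If that support contains a \<open>W\<^sub>I\<close>-conjugate \<open>K\<close> of \<open>J\<close>, only finitely many \<open>v\<close> are
  possible: two of them inducing the same map on \<open>K\<close> differ by an element centralizing \<open>K\<close>, which
  lies in \<open>W\<^sub>I\<close>.  This is the finiteness in (1), because a non-zero term at \<open>T\<^sub>w\<close> satisfies
  \<open>\<ell> (v\<^sub>1 v\<^sub>2 v\<^sub>1\<^sup>-\<^sup>1) \<le> \<ell> w\<close>.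

  The induced form is the trace over the right \<open>H\<^sub>I\<close>-basis \<open>T\<^sub>v\<close>, \<open>v \<in> W\<^sup>I\<close>, of \<open>H\<close>, followed by \<open>f\<close>;
  comparing \<open>T\<^sub>s h\<close> with \<open>h T\<^sub>s\<close> through Deodhar's alternative (\<open>s v \<in> W\<^sup>I\<close> or \<open>s v = v t\<close>) gives (2).
  For (3) and (4), \<open>W\<^sub>K b \<inter> b W\<^sub>I\<close> is described by Kilmoyer's theorem for a minimal double coset
  representative \<open>b\<close>; in (3), \<open>b\<close> moreover conjugates one subset of \<open>S\<close> to another and is decomposed
  into elementary steps, each of which lies in \<open>W\<^sub>I\<close>.  Modulo \<open>q - 1\<close> the algebra becomes the group
  ring, where the constant attached to a class is the number of fixed cosets \<open>v W\<^sub>I\<close>.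
\<close>

section \<open>Length and exchange\<close>

context crystallographic_coxeter_system
begin

abbreviation len ("\<ell>") where "\<ell> \<equiv> cox_length W S"

abbreviation word ("\<pi>") where "\<pi> \<equiv> word_prod W"

definition reduced :: "'a list \<Rightarrow> bool" where
  "reduced xs \<longleftrightarrow> xs \<in> lists S \<and> length xs = \<ell> (\<pi> xs)"

lemma S_carrier [simp]: "s \<in> S \<Longrightarrow> s \<in> carrier W"
  using S_subset by blast

lemma S_cancel [simp]: "\<lbrakk>s \<in> S; x \<in> carrier W\<rbrakk> \<Longrightarrow> s \<otimes> (s \<otimes> x) = x"
  by (simp add: involution flip: m_assoc)

lemma inv_S [simp]: "s \<in> S \<Longrightarrow> inv s = s"
  by (simp add: involution inv_equality)

lemma inv_cancel [simp]:
  assumes "g \<in> carrier W" "x \<in> carrier W"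
  shows "inv g \<otimes> (g \<otimes> x) = x" "g \<otimes> (inv g \<otimes> x) = x"
  using assms by (simp_all flip: m_assoc)

lemma conj_iff:
  assumes "g \<in> carrier W" "x \<in> carrier W" "y \<in> carrier W"
  shows "inv g \<otimes> x \<otimes> g = y \<longleftrightarrow> x = g \<otimes> y \<otimes> inv g"
proof
  assume "inv g \<otimes> x \<otimes> g = y"
  moreover have "g \<otimes> (inv g \<otimes> x \<otimes> g) \<otimes> inv g = x"
    using assms by (simp add: m_assoc)
  ultimately show "x = g \<otimes> y \<otimes> inv g" by simp
next
  assume "x = g \<otimes> y \<otimes> inv g"
  then show "inv g \<otimes> x \<otimes> g = y"
    using assms by (simp add: m_assoc)
qed

lemma word_Nil [simp]: "\<pi> [] = \<one>"
  and word_Cons [simp]: "\<pi> (x # xs) = x \<otimes> \<pi> xs"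
  by (simp_all add: word_prod_def)

lemma word_closed [simp]: "xs \<in> lists S \<Longrightarrow> \<pi> xs \<in> carrier W"
  by (induction xs) auto

lemma word_append: "\<lbrakk>xs \<in> lists S; ys \<in> lists S\<rbrakk> \<Longrightarrow> \<pi> (xs @ ys) = \<pi> xs \<otimes> \<pi> ys"
  by (induction xs) (auto simp: m_assoc)

lemma word_rev: "xs \<in> lists S \<Longrightarrow> \<pi> (rev xs) = inv (\<pi> xs)"
proof (induction xs)
  case (Cons s xs)
  then have "s \<in> S" "xs \<in> lists S" "rev xs \<in> lists S" by auto
  with Cons.IH show ?case by (simp add: word_append inv_mult_group)
qed simp

lemma generate_closed [simp]: "I \<subseteq> S \<Longrightarrow> x \<in> generate W I \<Longrightarrow> x \<in> carrier W"
  using generate_in_carrier S_subset by blast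

lemma word_generate:
  assumes "I \<subseteq> S" "xs \<in> lists I"
  shows "\<pi> xs \<in> generate W I"
  using assms(2) by induction (auto intro: generate.intros)

lemma generate_ex_word:
  assumes "I \<subseteq> S" "w \<in> generate W I"
  shows "\<exists>xs\<in>lists I. \<pi> xs = w"
  using assms(2)
proof induction
  case one
  show ?case by (rule bexI[of _ "[]"]) auto
next
  case (incl h)
  with assms(1) show ?case by (intro bexI[of _ "[h]"]) auto
next
  case (inv h)
  with assms(1) show ?case by (intro bexI[of _ "[h]"]) auto
next
  case (eng g h)
  then obtain xs ys where "xs \<in> lists I" "ys \<in> lists I" "\<pi> xs = g" "\<pi> ys = h" by blast
  moreover have "lists I \<subseteq> lists S" using assms(1) by (rule lists_mono)
  ultimately show ?case
    by (intro bexI[of _ "xs @ ys"]) (auto simp: word_append subset_iff)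
qed

lemma ex_word: "w \<in> carrier W \<Longrightarrow> \<exists>xs\<in>lists S. \<pi> xs = w"
  using generate_ex_word[of S] generated by simp

lemma len_word_le: "xs \<in> lists S \<Longrightarrow> \<ell> (\<pi> xs) \<le> length xs"
  unfolding cox_length_def by (rule Least_le) blast

lemma ex_reduced:
  assumes "w \<in> carrier W"
  obtains xs where "reduced xs" "\<pi> xs = w"
proof -
  have "\<exists>n. \<exists>xs\<in>lists S. length xs = n \<and> \<pi> xs = w"
    using ex_word[OF assms] by blast
  then have "\<exists>xs\<in>lists S. length xs = \<ell> w \<and> \<pi> xs = w"
    unfolding cox_length_def by (rule LeastI_ex)
  then show ?thesis using that unfolding reduced_def by blast
qed

lemma len_one [simp]: "\<ell> \<one> = 0"
  using len_word_le[of "[]"] by simp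

lemma len_mult_le:
  assumes "x \<in> carrier W" "y \<in> carrier W"
  shows "\<ell> (x \<otimes> y) \<le> \<ell> x + \<ell> y"
proof -
  obtain xs where xs: "reduced xs" "\<pi> xs = x" using ex_reduced assms by blast
  obtain ys where ys: "reduced ys" "\<pi> ys = y" using ex_reduced assms by blast
  show ?thesis
    using len_word_le[of "xs @ ys"] xs ys by (auto simp: reduced_def word_append)
qed

lemma len_inv_le: "x \<in> carrier W \<Longrightarrow> \<ell> (inv x) \<le> \<ell> x"
proof -
  assume "x \<in> carrier W"
  then obtain xs where xs: "reduced xs" "\<pi> xs = x" using ex_reduced by blast
  have "rev xs \<in> lists S" using xs(1) by (auto simp: reduced_def)
  then show ?thesis
    using len_word_le[of "rev xs"] xs by (auto simp: reduced_def word_rev)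
qed

lemma len_inv [simp]: "x \<in> carrier W \<Longrightarrow> \<ell> (inv x) = \<ell> x"
  using len_inv_le[of x] len_inv_le[of "inv x"] by simp

lemma len_eq_0D: "x \<in> carrier W \<Longrightarrow> \<ell> x = 0 \<Longrightarrow> x = \<one>"
  by (metis ex_reduced length_0_conv reduced_def word_Nil)

lemma len_S [simp]: "s \<in> S \<Longrightarrow> \<ell> s = 1"
  using len_word_le[of "[s]"] len_eq_0D[of s] not_one[of s] by fastforce

lemma finite_ball: "finite {w \<in> carrier W. \<ell> w \<le> n}"
proof (rule finite_subset)
  show "{w \<in> carrier W. \<ell> w \<le> n} \<subseteq> \<pi> ` {xs. set xs \<subseteq> S \<and> length xs \<le> n}"
  proof
    fix w assume w: "w \<in> {w \<in> carrier W. \<ell> w \<le> n}"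
    then obtain xs where "reduced xs" "\<pi> xs = w" using ex_reduced by blast
    with w show "w \<in> \<pi> ` {xs. set xs \<subseteq> S \<and> length xs \<le> n}"
      by (auto simp: reduced_def)
  qed
qed (simp add: finite_S finite_lists_length_le)

section \<open>Parity of the reflections along a word, and the exchange condition\<close>

text \<open>The parity of the number of \<open>i\<close> with \<open>t = s\<^sub>1 \<cdots> s\<^sub>i \<cdots> s\<^sub>1\<close>, for the word \<open>s\<^sub>1 \<cdots> s\<^sub>k\<close>.\<close>
primrec par :: "'a list \<Rightarrow> 'a \<Rightarrow> bool" where
  "par [] t = False"
| "par (s # xs) t = ((t = s) \<noteq> par xs (s \<otimes> t \<otimes> s))"

text \<open>The letters of \<open>ys\<close> contribute to the longer word their reflections within
  \<open>ys\<close>, conjugated by \<open>\<pi> xs\<close>. Conjugating \<open>t\<close> back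
  instead makes the two parities add.\<close>

lemma par_append:
  "\<lbrakk>xs \<in> lists S; ys \<in> lists S; t \<in> carrier W\<rbrakk> \<Longrightarrow>
    par (xs @ ys) t = (par xs t \<noteq> par ys (inv (\<pi> xs) \<otimes> t \<otimes> \<pi> xs))"
proof (induction xs arbitrary: t)
  case (Cons s xs)
  then have s: "s \<in> S" "xs \<in> lists S" by auto
  have "inv (\<pi> xs) \<otimes> (s \<otimes> t \<otimes> s) \<otimes> \<pi> xs = inv (\<pi> (s # xs)) \<otimes> t \<otimes> \<pi> (s # xs)"
    using s Cons.prems by (simp add: inv_mult_group m_assoc)
  then show ?case using Cons s by auto
qed auto

lemma word_relator:
  assumes "s \<in> S" "t \<in> S"
  shows "\<pi> (concat (replicate n [s, t])) = (s \<otimes> t) [^] n"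
proof (induction n)
  case (Suc n)
  then show ?case using assms nat_pow_Suc2[of "s \<otimes> t" n] by (simp add: m_assoc)
qed simp

lemma relator_lists: "s \<in> S \<Longrightarrow> t \<in> S \<Longrightarrow> concat (replicate n [s, t]) \<in> lists S"
  by (induction n) auto

text \<open>The reflections met along the word s t s t ... with 2n letters are (s t)^j s for j < 2n.
  They are counted with repetition, since they may coincide when s t has finite order.\<close>

lemma par_relator:
  assumes s: "s \<in> S" and t: "t \<in> S" and u: "u \<in> carrier W"
  shows "par (concat (replicate n [s, t])) u =
    odd (\<Sum>j<2*n. if u = (s \<otimes> t) [^] j \<otimes> s then 1 else 0 :: nat)"
  using u
proof (induction n arbitrary: u)
  case (Suc n)
  define p where "p = s \<otimes> t"
  have p: "p \<in> carrier W" using s t by (simp add: p_def)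
  let ?c = "\<lambda>u j. if u = p [^] j \<otimes> s then 1 else 0 :: nat"
  define u' where "u' = t \<otimes> (s \<otimes> u \<otimes> s) \<otimes> t"
  have u': "u' \<in> carrier W" using s t Suc.prems by (simp add: u'_def)
  have up: "u' = inv p \<otimes> u \<otimes> p"
    using s t Suc.prems by (simp add: u'_def p_def inv_mult_group m_assoc)
  \<comment> \<open>Conjugation by \<open>s\<close> inverts \<open>p\<close>, so conjugation by
    \<open>p\<close> multiplies a reflection p^j s by p^2. This is the shift of the index by two
    caused by one more pair of letters.\<close>
  have sp: "s \<otimes> inv p = p \<otimes> s"
    using s t by (simp add: p_def inv_mult_group m_assoc)
  have shift: "?c u' j = ?c u (Suc (Suc j))" for j
  proof -
    have "u' = p [^] j \<otimes> s \<longleftrightarrow> u = p \<otimes> (p [^] j \<otimes> s) \<otimes> inv p"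
      unfolding up using conj_iff[of p u "p [^] j \<otimes> s"] p s Suc.prems by simp
    also have "p \<otimes> (p [^] j \<otimes> s) \<otimes> inv p = p \<otimes> (p [^] j \<otimes> (p \<otimes> s))"
      using p s sp by (simp add: m_assoc)
    also have "\<dots> = p [^] Suc (Suc j) \<otimes> s"
    proof -
      have "p [^] Suc (Suc j) = p \<otimes> (p [^] j \<otimes> p)"
        using p nat_pow_Suc2[OF p, of "Suc j"] by simp
      then show ?thesis using p s by (simp only: m_assoc m_closed nat_pow_closed S_carrier)
    qed
    finally show ?thesis by simp
  qed
  have "par (concat (replicate (Suc n) [s, t])) u =
      ((u = s) \<noteq> ((s \<otimes> u \<otimes> s = t) \<noteq> odd (\<Sum>j<2*n. ?c u' j)))"
    using Suc.IH[OF u'] by (simp add: u'_def p_def)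
  also have "(s \<otimes> u \<otimes> s = t) \<longleftrightarrow> (u = p \<otimes> s)"
    using s t Suc.prems unfolding p_def
    using conj_iff[of s u t] by (simp add: m_assoc)
  also have "(\<Sum>j<2*n. ?c u' j) = (\<Sum>j<2*n. ?c u (Suc (Suc j)))" by (simp add: shift)
  also have "((u = s) \<noteq> ((u = p \<otimes> s) \<noteq> odd (\<Sum>j<2*n. ?c u (Suc (Suc j))))) =
      odd (\<Sum>j<Suc (Suc (2*n)). ?c u j)"
    using s p by (simp add: sum.lessThan_Suc_shift del: sum.lessThan_Suc nat_pow_Suc)
  finally show ?case by (simp add: p_def)
qed simp

text \<open>With m the order of s t, the elements (s t)^j s are periodic in j with period m. Each is
  met an even number of times for j < 2m, so inserting a relator changes no parity.\<close>

lemma par_coxeter_equiv: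
  "coxeter_equiv W S xs ys \<Longrightarrow>
    xs \<in> lists S \<and> ys \<in> lists S \<and> (\<forall>t\<in>carrier W. par xs t = par ys t)"
proof (induction rule: coxeter_equiv.induct)
  case (relation s t xs ys)
  let ?n = "ord (s \<otimes> t)"
  let ?R = "concat (replicate ?n [s, t])"
  have R: "?R \<in> lists S" using relation relator_lists by blast
  have p: "(s \<otimes> t) [^] ?n = \<one>" using relation by (simp add: pow_ord_eq_1)
  have parR: "\<not> par ?R u" if u: "u \<in> carrier W" for u
  proof -
    let ?c = "\<lambda>j. if u = (s \<otimes> t) [^] j \<otimes> s then 1 else 0 :: nat"
    have "?c (?n + j) = ?c j" for j
      using relation p by (simp flip: nat_pow_mult)
    then have "(\<Sum>j<?n. ?c (?n + j)) = (\<Sum>j<?n. ?c j)" by simp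
    moreover have "(\<Sum>j<?n + k. ?c j) = (\<Sum>j<?n. ?c j) + (\<Sum>j<k. ?c (?n + j))" for k
      by (induction k) simp_all
    ultimately show ?thesis using par_relator[of s t u ?n] relation u by (simp add: mult_2)
  qed
  have \<pi>R: "\<pi> ?R = \<one>" using relation p by (simp add: word_relator)
  have "par (xs @ ?R @ ys) t' = par (xs @ ys) t'" if "t' \<in> carrier W" for t'
    using that relation R \<pi>R parR by (simp add: par_append word_append)
  with relation R show ?case by auto
qed auto

text \<open>The choice of a word is harmless by \<open>inversion_word\<close>. For a reflection
  \<open>t\<close> this is the usual notion of a left inversion of \<open>w\<close>, as
  \<open>reflection_less_iff\<close> shows.\<close>

definition inversion :: "'a \<Rightarrow> 'a \<Rightarrow> bool" where
  "inversion w t = par (SOME xs. xs \<in> lists S \<and> \<pi> xs = w) t"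

text \<open>The presentation of \<open>W\<close> enters here: two words for the same element are
  linked by relators, which leave the parity unchanged.\<close>

lemma inversion_word:
  assumes "xs \<in> lists S" "t \<in> carrier W"
  shows "inversion (\<pi> xs) t = par xs t"
proof -
  let ?ys = "SOME ys. ys \<in> lists S \<and> \<pi> ys = \<pi> xs"
  have "?ys \<in> lists S \<and> \<pi> ?ys = \<pi> xs" by (rule someI) (use assms in auto)
  then have "coxeter_equiv W S ?ys xs" using presentation assms by auto
  then show ?thesis using par_coxeter_equiv assms(2) unfolding inversion_def by blast
qed

lemma inversion_mult:
  assumes "x \<in> carrier W" "y \<in> carrier W" "t \<in> carrier W"
  shows "inversion (x \<otimes> y) t = (inversion x t \<noteq> inversion y (inv x \<otimes> t \<otimes> x))"
proof -
  obtain xs ys where "xs \<in> lists S" "ys \<in> lists S" and xy: "x = \<pi> xs" "y = \<pi> ys"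
    using assms ex_word by metis
  then show ?thesis
    using assms by (auto simp: inversion_word par_append simp flip: word_append)
qed

lemma inversion_one [simp]: "t \<in> carrier W \<Longrightarrow> \<not> inversion \<one> t"
  using inversion_word[of "[]"] by simp

lemma inversion_S [simp]: "s \<in> S \<Longrightarrow> t \<in> carrier W \<Longrightarrow> inversion s t \<longleftrightarrow> t = s"
  using inversion_word[of "[s]"] by simp

text \<open>An odd count means that \<open>t\<close> is the reflection of some letter. Multiplying
  by \<open>t\<close> deletes the first such letter and moves no other.\<close>

lemma par_delete:
  "\<lbrakk>xs \<in> lists S; t \<in> carrier W; par xs t\<rbrakk> \<Longrightarrow>
    \<exists>ys\<in>lists S. t \<otimes> \<pi> xs = \<pi> ys \<and> length xs = Suc (length ys) \<and> set ys \<subseteq> set xs"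
proof (induction xs arbitrary: t)
  case (Cons s xs)
  then have s: "s \<in> S" "xs \<in> lists S" by auto
  show ?case
  proof (cases "t = s")
    case True
    with s show ?thesis by (intro bexI[of _ xs]) auto
  next
    case False
    then have "par xs (s \<otimes> t \<otimes> s)" using Cons.prems by simp
    from Cons.IH[OF s(2) _ this] obtain ys where ys: "ys \<in> lists S"
      "s \<otimes> t \<otimes> s \<otimes> \<pi> xs = \<pi> ys" "length xs = Suc (length ys)" "set ys \<subseteq> set xs"
      using s Cons.prems by auto
    have "t \<otimes> \<pi> (s # xs) = s \<otimes> (s \<otimes> t \<otimes> s \<otimes> \<pi> xs)"
      using s Cons.prems by (simp add: m_assoc)
    with ys s show ?thesis by (intro bexI[of _ "s # ys"]) auto
  qed
qed simp

lemma inversion_less: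
  assumes "w \<in> carrier W" "t \<in> carrier W" "inversion w t"
  shows "\<ell> (t \<otimes> w) < \<ell> w"
proof -
  obtain xs where xs: "reduced xs" "\<pi> xs = w" using ex_reduced assms by blast
  with assms obtain ys where "ys \<in> lists S" "t \<otimes> w = \<pi> ys" "length xs = Suc (length ys)"
    using par_delete[of xs t] inversion_word[of xs t] by (auto simp: reduced_def)
  then show ?thesis using len_word_le[of ys] xs by (auto simp: reduced_def)
qed

text \<open>In the product of \<open>g\<close>, \<open>s\<close> and \<open>inv g\<close> the
  contributions of the two outer factors cancel, because \<open>g \<otimes> inv g\<close> has no
  inversions. The middle letter contributes exactly one.\<close>

lemma inversion_reflection:
  assumes "g \<in> carrier W" "s \<in> S"
  shows "inversion (g \<otimes> s \<otimes> inv g) (g \<otimes> s \<otimes> inv g)"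
proof -
  let ?t = "g \<otimes> s \<otimes> inv g"
  have t: "?t \<in> carrier W" using assms by simp
  have gt: "inv g \<otimes> ?t \<otimes> g = s" using assms by (simp add: m_assoc inv_solve_left')
  have "\<not> inversion (g \<otimes> inv g) ?t" using assms by simp
  then have *: "inversion g ?t = inversion (inv g) s"
    using inversion_mult[of g "inv g" ?t] gt assms by simp
  have "inversion (g \<otimes> (s \<otimes> inv g)) ?t = (inversion g ?t \<noteq> inversion (s \<otimes> inv g) s)"
    using inversion_mult[of g "s \<otimes> inv g" ?t] gt assms by simp
  also have "inversion (s \<otimes> inv g) s = (\<not> inversion (inv g) s)"
    using inversion_mult[of s "inv g" s] assms by (simp add: involution)
  finally show ?thesis using * assms by (simp add: m_assoc)
qed

text \<open>The strong exchange condition.\<close>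
lemma reflection_less_iff:
  assumes w: "w \<in> carrier W" and g: "g \<in> carrier W" "s \<in> S"
  shows "\<ell> (g \<otimes> s \<otimes> inv g \<otimes> w) < \<ell> w \<longleftrightarrow> inversion w (g \<otimes> s \<otimes> inv g)"
    and "\<ell> w < \<ell> (g \<otimes> s \<otimes> inv g \<otimes> w) \<longleftrightarrow> \<not> inversion w (g \<otimes> s \<otimes> inv g)"
proof -
  let ?t = "g \<otimes> s \<otimes> inv g"
  have t: "?t \<in> carrier W" using g by simp
  have tt: "?t \<otimes> ?t = \<one>" using g by (simp add: m_assoc)
  then have inv_t: "inv ?t = ?t" using t inv_equality by blast
  \<comment> \<open>Exactly one of \<open>w\<close> and \<open>?t \<otimes> w\<close> has
    \<open>?t\<close> as an inversion, so \<open>inversion_less\<close>, applied to that one,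
    decides the comparison in both cases.\<close>
  have "inversion (?t \<otimes> w) ?t \<longleftrightarrow> \<not> inversion w ?t"
    using inversion_mult[of ?t w ?t] inversion_reflection[OF g] t w by (simp add: inv_t tt)
  moreover have "?t \<otimes> (?t \<otimes> w) = w" using t w m_assoc[of ?t ?t w] tt by simp
  moreover have "?t \<otimes> w \<in> carrier W" using t w by simp
  ultimately have "if inversion w ?t then \<ell> (?t \<otimes> w) < \<ell> w else \<ell> w < \<ell> (?t \<otimes> w)"
    using inversion_less[OF w t] inversion_less[OF _ t, of "?t \<otimes> w"] by presburger
  then show "\<ell> (?t \<otimes> w) < \<ell> w \<longleftrightarrow> inversion w ?t"
    and "\<ell> w < \<ell> (?t \<otimes> w) \<longleftrightarrow> \<not> inversion w ?t"
    by (auto split: if_splits)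
qed

lemma left_less_iff:
  assumes "w \<in> carrier W" "s \<in> S"
  shows "\<ell> (s \<otimes> w) < \<ell> w \<longleftrightarrow> inversion w s" "\<ell> w < \<ell> (s \<otimes> w) \<longleftrightarrow> \<not> inversion w s"
  using reflection_less_iff[of w \<one> s] assms by auto

lemma right_less_iff:
  assumes "w \<in> carrier W" "s \<in> S"
  shows "\<ell> (w \<otimes> s) < \<ell> w \<longleftrightarrow> inversion w (w \<otimes> s \<otimes> inv w)"
    "\<ell> w < \<ell> (w \<otimes> s) \<longleftrightarrow> \<not> inversion w (w \<otimes> s \<otimes> inv w)"
  using reflection_less_iff[of w w s] assms by (simp_all add: m_assoc)

lemma left_less_cases:
  assumes "w \<in> carrier W" "s \<in> S"
  obtains (up) "\<ell> (s \<otimes> w) = Suc (\<ell> w)" "\<not> \<ell> (s \<otimes> w) < \<ell> w"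
    | (down) "\<ell> w = Suc (\<ell> (s \<otimes> w))" "\<ell> (s \<otimes> w) < \<ell> w"
proof -
  have "\<ell> (s \<otimes> w) \<le> Suc (\<ell> w)" "\<ell> w \<le> Suc (\<ell> (s \<otimes> w))"
    using len_mult_le[of s w] len_mult_le[of s "s \<otimes> w"] assms by auto
  moreover have "\<ell> (s \<otimes> w) < \<ell> w \<or> \<ell> w < \<ell> (s \<otimes> w)" using left_less_iff assms by blast
  ultimately show ?thesis using that by linarith
qed

lemma right_less_cases:
  assumes "w \<in> carrier W" "s \<in> S"
  obtains (up) "\<ell> (w \<otimes> s) = Suc (\<ell> w)" "\<not> \<ell> (w \<otimes> s) < \<ell> w"
    | (down) "\<ell> w = Suc (\<ell> (w \<otimes> s))" "\<ell> (w \<otimes> s) < \<ell> w"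
proof -
  have "\<ell> (inv w) = \<ell> w" "\<ell> (s \<otimes> inv w) = \<ell> (w \<otimes> s)"
    using assms len_inv[of "w \<otimes> s"] by (simp_all add: inv_mult_group)
  moreover have "inv w \<in> carrier W" using assms by simp
  ultimately show ?thesis using assms(2) that
    by (elim left_less_cases[of "inv w" s]) simp_all
qed

lemma reduced_ConsD:
  assumes "reduced (s # xs)"
  shows "reduced xs" "s \<in> S" "\<pi> xs \<in> carrier W" "\<ell> (s \<otimes> \<pi> xs) = Suc (\<ell> (\<pi> xs))"
proof -
  have s: "s \<in> S" "xs \<in> lists S" using assms by (auto simp: reduced_def)
  then show "s \<in> S" "\<pi> xs \<in> carrier W" by auto
  have "\<ell> (s \<otimes> \<pi> xs) = Suc (length xs)" using assms by (simp add: reduced_def)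
  moreover have "\<ell> (\<pi> xs) \<le> length xs" using len_word_le s by blast
  moreover have "\<ell> (s \<otimes> \<pi> xs) \<le> Suc (\<ell> (\<pi> xs))" using len_mult_le[of s "\<pi> xs"] s by simp
  ultimately show "reduced xs" "\<ell> (s \<otimes> \<pi> xs) = Suc (\<ell> (\<pi> xs))"
    using s by (auto simp: reduced_def)
qed

text \<open>Exchange only deletes letters, so a word can be reduced without leaving its alphabet.
  Hence the length function of W_I is the restriction of that of \<open>W\<close>.\<close>

lemma reduced_subword:
  "xs \<in> lists S \<Longrightarrow> \<exists>ys. reduced ys \<and> \<pi> ys = \<pi> xs \<and> set ys \<subseteq> set xs"
proof (induction xs)
  case Nil
  show ?case by (rule exI[of _ "[]"]) (simp add: reduced_def)
next
  case (Cons s xs)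
  then have s: "s \<in> S" by auto
  from Cons obtain ys where ys: "reduced ys" "\<pi> ys = \<pi> xs" "set ys \<subseteq> set xs" by auto
  have ysS: "ys \<in> lists S" using ys by (simp add: reduced_def)
  from word_closed[OF ysS] s show ?case
  proof (cases rule: left_less_cases)
    case up
    then have "reduced (s # ys)" using ys s by (simp add: reduced_def)
    with ys show ?thesis by (intro exI[of _ "s # ys"]) auto
  next
    case down
    then have "par ys s" using left_less_iff(1)[of "\<pi> ys" s] inversion_word[of ys s] ysS s by simp
    then obtain zs where zs: "zs \<in> lists S" "s \<otimes> \<pi> ys = \<pi> zs"
      "length ys = Suc (length zs)" "set zs \<subseteq> set ys"
      using par_delete[of ys s] ysS s by auto
    then have "reduced zs" using down ys by (simp add: reduced_def)
    with zs ys show ?thesis by (intro exI[of _ zs]) auto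
  qed
qed

lemma generate_ex_reduced:
  assumes "I \<subseteq> S" "x \<in> generate W I"
  obtains xs where "reduced xs" "xs \<in> lists I" "\<pi> xs = x"
proof -
  obtain ys where "ys \<in> lists I" "\<pi> ys = x" using generate_ex_word assms by blast
  moreover have "lists I \<subseteq> lists S" using assms(1) by (rule lists_mono)
  ultimately obtain zs where "reduced zs" "\<pi> zs = x" "set zs \<subseteq> I"
    using reduced_subword[of ys] by (auto simp: subset_iff)
  then show ?thesis using that by auto
qed

section \<open>Minimal coset representatives\<close>

abbreviation reps where "reps \<equiv> min_coset_reps W S"

lemma generate_mult [simp]:
  "\<lbrakk>x \<in> generate W I; y \<in> generate W I\<rbrakk> \<Longrightarrow> x \<otimes> y \<in> generate W I"
  by (rule generate.eng)

lemma generate_inv [simp]: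
  "\<lbrakk>I \<subseteq> S; x \<in> generate W I\<rbrakk> \<Longrightarrow> inv x \<in> generate W I"
  using generate_m_inv_closed S_subset by blast

lemma generate_incl [simp]: "s \<in> I \<Longrightarrow> s \<in> generate W I"
  by (rule generate.incl)

lemma generate_one [simp]: "\<one> \<in> generate W I"
  by (rule generate.one)

lemma repsD:
  assumes "v \<in> reps I"
  shows "v \<in> carrier W" "t \<in> I \<Longrightarrow> \<ell> v < \<ell> (v \<otimes> t)"
  using assms by (auto simp: min_coset_reps_def)

lemma reps_antimono: "K \<subseteq> I \<Longrightarrow> reps I \<subseteq> reps K"
  by (auto simp: min_coset_reps_def)

text \<open>First for elements of globally minimal length in their coset; that the local condition
  defining \<open>W\<^sup>I\<close> already forces this is \<open>reps_minimal\<close> below.\<close>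
lemma minimal_len_mult:
  assumes I: "I \<subseteq> S" and u: "u \<in> carrier W"
    and min: "\<And>y. y \<in> generate W I \<Longrightarrow> \<ell> u \<le> \<ell> (u \<otimes> y)"
    and x: "x \<in> generate W I"
  shows "\<ell> (u \<otimes> x) = \<ell> u + \<ell> x"
proof -
  \<comment> \<open>Right descents of \<open>u \<otimes> x\<close> in \<open>I\<close> are those of
    \<open>x\<close>: by minimality of \<open>u\<close>, no conjugate by \<open>u\<close> of a
    reflection of W_I is an inversion of \<open>u\<close>, so the cocycle rule passes the question
    on to \<open>x\<close>.\<close>
  have step: "\<ell> (u \<otimes> (x \<otimes> t)) < \<ell> (u \<otimes> x) \<longleftrightarrow> \<ell> (x \<otimes> t) < \<ell> x"
    if x: "x \<in> generate W I" and t: "t \<in> I" for x t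
  proof -
    have c: "x \<in> carrier W" "t \<in> S" using that I by auto
    let ?r = "x \<otimes> t \<otimes> inv x"
    have r: "?r \<in> generate W I" using that I by simp
    have rc: "?r \<in> carrier W" using c by simp
    let ?g = "u \<otimes> x"
    have e: "?g \<otimes> t \<otimes> inv ?g = u \<otimes> ?r \<otimes> inv u"
      using u c by (simp add: m_assoc inv_mult_group)
    have e': "u \<otimes> ?r \<otimes> inv u \<otimes> u = u \<otimes> ?r"
      using u c by (simp add: m_assoc)
    have "\<not> \<ell> (u \<otimes> ?r \<otimes> inv u \<otimes> u) < \<ell> u" using min[OF r] unfolding e' by simp
    then have n: "\<not> inversion u (u \<otimes> ?r \<otimes> inv u)"
      using reflection_less_iff(1)[of u ?g t] u c unfolding e by simp
    have "inv u \<otimes> (u \<otimes> ?r \<otimes> inv u) \<otimes> u = ?r"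
      using conj_iff[of u "u \<otimes> ?r \<otimes> inv u" ?r] u rc by simp
    then have "inversion ?g (u \<otimes> ?r \<otimes> inv u) \<longleftrightarrow> inversion x ?r"
      using inversion_mult[of u x "u \<otimes> ?r \<otimes> inv u"] n u c by simp
    then show ?thesis
      using right_less_iff(1)[of ?g t] right_less_iff(1)[of x t] u c unfolding e
      by (simp add: m_assoc)
  qed
  obtain xs where xs: "reduced xs" "xs \<in> lists I" "\<pi> xs = x"
    using generate_ex_reduced I x by blast
  \<comment> \<open>Letters have to be appended on the right of \<open>u\<close>, whereas list
    induction works from the left. Hence the induction runs over the reversed word.\<close>
  have "reduced (rev xs)" if "reduced xs" for xs
  proof -
    have "rev xs \<in> lists S" "xs \<in> lists S" using that by (auto simp: reduced_def)
    then show ?thesis using that by (simp add: reduced_def word_rev)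
  qed
  with xs have "reduced (rev xs)" by blast
  moreover have "rev xs \<in> lists I" using xs by auto
  ultimately have "\<ell> (u \<otimes> inv (\<pi> (rev xs))) = \<ell> u + length (rev xs)"
  proof (induction "rev xs" arbitrary: xs)
    case Nil
    then show ?case using u by simp
  next
    case (Cons t zs)
    have zs: "reduced zs" "zs \<in> lists I" "t \<in> I" using Cons reduced_ConsD(1)[of t zs]
      by (auto simp flip: Cons(2))
    have tS: "t \<in> S" and z: "\<pi> zs \<in> carrier W" "\<pi> zs \<in> generate W I"
      using zs I word_generate reduced_def by auto
    have IH: "\<ell> (u \<otimes> inv (\<pi> zs)) = \<ell> u + length zs"
      using Cons(1)[of "rev zs"] zs by simp
    let ?x = "inv (\<pi> zs)"
    have "\<ell> (?x \<otimes> t) = \<ell> (t \<otimes> \<pi> zs)"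
      using z tS len_inv[of "t \<otimes> \<pi> zs"] by (simp add: inv_mult_group)
    also have "\<dots> = Suc (\<ell> (\<pi> zs))" using reduced_ConsD(4)[of t zs] Cons by simp
    finally have "\<not> \<ell> (?x \<otimes> t) < \<ell> ?x" using z by simp
    then have "\<not> \<ell> (u \<otimes> (?x \<otimes> t)) < \<ell> (u \<otimes> ?x)" using step[of ?x t] z zs I by simp
    then have "\<ell> (u \<otimes> ?x \<otimes> t) = Suc (\<ell> (u \<otimes> ?x))"
      using u z tS right_less_cases[of "u \<otimes> ?x" t] by (metis inv_closed m_assoc m_closed S_carrier)
    then show ?case
      using IH u z tS by (simp flip: Cons(2) add: inv_mult_group m_assoc)
  qed
  moreover have "xs \<in> lists S" using xs reduced_def by blast
  moreover have "inv (inv x) = x" using x I by simp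
  ultimately show ?thesis using xs by (simp add: word_rev reduced_def)
qed

lemma ex_minimal:
  assumes I: "I \<subseteq> S" and w: "w \<in> carrier W"
  obtains u x where "u \<in> carrier W" "x \<in> generate W I" "w = u \<otimes> x"
    "\<And>y. y \<in> generate W I \<Longrightarrow> \<ell> u \<le> \<ell> (u \<otimes> y)"
proof -
  obtain y where y: "y \<in> generate W I" and
    min: "\<And>z. z \<in> generate W I \<Longrightarrow> \<ell> (w \<otimes> y) \<le> \<ell> (w \<otimes> z)"
    using ex_has_least_nat[of "\<lambda>y. y \<in> generate W I" \<one> "\<lambda>y. \<ell> (w \<otimes> y)"] by auto
  have yc: "y \<in> carrier W" using y I by simp
  show ?thesis
  proof (rule that[of "w \<otimes> y" "inv y"])
    fix z assume z: "z \<in> generate W I"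
    then show "\<ell> (w \<otimes> y) \<le> \<ell> (w \<otimes> y \<otimes> z)"
      using min[of "y \<otimes> z"] y w I by (simp add: m_assoc)
  qed (use w y yc I in \<open>simp_all add: m_assoc\<close>)
qed

text \<open>Write \<open>v\<close> as \<open>u \<otimes> x\<close> with \<open>u\<close> globally
  minimal. If \<open>x\<close> were not trivial, a right descent of \<open>x\<close> in
  \<open>I\<close> would, by additivity of lengths, be a right descent of \<open>v\<close>.\<close>

lemma reps_minimal:
  assumes I: "I \<subseteq> S" and v: "v \<in> reps I" and y: "y \<in> generate W I"
  shows "\<ell> v \<le> \<ell> (v \<otimes> y)"
proof -
  have vc: "v \<in> carrier W" using v repsD by blast
  obtain u x where ux: "u \<in> carrier W" "x \<in> generate W I" "v = u \<otimes> x"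
    and min: "\<And>y. y \<in> generate W I \<Longrightarrow> \<ell> u \<le> \<ell> (u \<otimes> y)"
    using ex_minimal[OF I vc] by blast
  note add = minimal_len_mult[OF I ux(1) min]
  obtain xs where xs: "reduced xs" "xs \<in> lists I" "\<pi> xs = inv x"
    using generate_ex_reduced[OF I, of "inv x"] ux I by auto
  have xc: "x \<in> carrier W" using ux I by simp
  have "x = \<one>"
  proof (cases xs)
    case Nil
    then have "inv x = \<one>" using xs by simp
    then show ?thesis using xc inv_eq_1_iff by blast
  next
    case (Cons t zs)
    then have t: "t \<in> I" "t \<in> S" using xs I by auto
    note d = reduced_ConsD[of t zs]
    have "inv x = t \<otimes> \<pi> zs" using xs Cons by simp
    then have "\<ell> (t \<otimes> inv x) < \<ell> (inv x)" using d xs(1) Cons by simp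
    moreover have "t \<otimes> inv x = inv (x \<otimes> t)" using t xc by (simp add: inv_mult_group)
    ultimately have "\<ell> (x \<otimes> t) < \<ell> x" using t xc by simp
    then have "\<ell> (u \<otimes> (x \<otimes> t)) < \<ell> (u \<otimes> x)" using add[of "x \<otimes> t"] add[of x] ux t by simp
    then have "\<ell> (v \<otimes> t) < \<ell> v" using ux t xc by (simp add: m_assoc)
    then show ?thesis using repsD(2)[OF v t(1)] by simp
  qed
  then show ?thesis using ux min y by simp
qed

lemma reps_len_mult:
  "\<lbrakk>I \<subseteq> S; v \<in> reps I; x \<in> generate W I\<rbrakk> \<Longrightarrow> \<ell> (v \<otimes> x) = \<ell> v + \<ell> x"
  using minimal_len_mult reps_minimal repsD(1) by blast

lemma ex_reps:
  assumes I: "I \<subseteq> S" and w: "w \<in> carrier W"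
  obtains v x where "v \<in> reps I" "x \<in> generate W I" "w = v \<otimes> x"
proof -
  obtain u x where ux: "u \<in> carrier W" "x \<in> generate W I" "w = u \<otimes> x"
    and min: "\<And>y. y \<in> generate W I \<Longrightarrow> \<ell> u \<le> \<ell> (u \<otimes> y)"
    using ex_minimal[OF I w] by blast
  have "\<ell> u < \<ell> (u \<otimes> t)" if "t \<in> I" for t
    using minimal_len_mult[OF I ux(1) min, of t] that I by auto
  then have "u \<in> reps I" using ux by (simp add: min_coset_reps_def)
  then show ?thesis using that ux by blast
qed

text \<open>Each of the two representatives is the other times an element of W_I. Lengths add in
  both directions, so that element has length 0.\<close>

lemma reps_unique:
  assumes I: "I \<subseteq> S" and v: "v \<in> reps I" "v' \<in> reps I"
    and x: "x \<in> generate W I" "x' \<in> generate W I" and eq: "v \<otimes> x = v' \<otimes> x'"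
  shows "v = v'" "x = x'"
proof -
  have c: "v \<in> carrier W" "v' \<in> carrier W" "x \<in> carrier W" "x' \<in> carrier W"
    using v x I repsD(1) by auto
  let ?y = "x \<otimes> inv x'"
  have y: "?y \<in> generate W I" using x I by simp
  have e: "v' = v \<otimes> ?y" using c eq inv_solve_right[of v' "v \<otimes> x" x'] by (simp flip: m_assoc)
  have e': "v = v' \<otimes> inv ?y" using c unfolding e by (simp add: m_assoc inv_mult_group)
  have "\<ell> v' = \<ell> v + \<ell> ?y" using reps_len_mult[OF I v(1) y] unfolding e[symmetric] .
  moreover have "\<ell> v = \<ell> v' + \<ell> (inv ?y)"
    using reps_len_mult[OF I v(2), of "inv ?y"] y I unfolding e'[symmetric] by simp
  ultimately have "?y = \<one>" using len_eq_0D[of ?y] c by simp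
  then show "v = v'" using e c by simp
  then show "x = x'" using eq c by simp
qed

lemma one_reps [simp]: "I \<subseteq> S \<Longrightarrow> \<one> \<in> reps I"
  using not_one by (fastforce simp: min_coset_reps_def)

lemma reps_generate:
  assumes "I \<subseteq> S" "v \<in> reps I" "v \<in> generate W I"
  shows "v = \<one>"
  using reps_unique(1)[of I v \<one> \<one> v] assms repsD(1)[OF assms(2)] by simp

text \<open>If \<open>s \<otimes> v\<close> leaves W^I, it has a right descent \<open>t\<close> in
  \<open>I\<close> that \<open>v\<close> does not have. The only inversion that \<open>s\<close> can
  create is the reflection \<open>s\<close> itself, which forces s = v t v^-1.\<close>

lemma deodhar:
  assumes I: "I \<subseteq> S" and v: "v \<in> reps I" and s: "s \<in> S"
  obtains (rep) "s \<otimes> v \<in> reps I" | (swap) t where "t \<in> I" "s \<otimes> v = v \<otimes> t"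
proof (cases "s \<otimes> v \<in> reps I")
  case False
  have vc: "v \<in> carrier W" using v repsD by blast
  from False obtain t where t: "t \<in> I" "\<not> \<ell> (s \<otimes> v) < \<ell> (s \<otimes> v \<otimes> t)"
    using vc s by (auto simp: min_coset_reps_def)
  have tS: "t \<in> S" using t I by blast
  let ?r = "v \<otimes> t \<otimes> inv v"
  have rc: "?r \<in> carrier W" using vc tS by simp
  have "\<not> inversion v ?r" using right_less_iff(2)[OF vc tS] repsD(2)[OF v t(1)] by simp
  moreover have "inversion (s \<otimes> v) (s \<otimes> ?r \<otimes> s)"
    using right_less_iff(2)[of "s \<otimes> v" t] t vc s tS by (simp add: inv_mult_group m_assoc)
  moreover have "s \<otimes> (s \<otimes> ?r \<otimes> s) \<otimes> s = ?r" using s rc by (simp add: m_assoc involution)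
  ultimately have "s \<otimes> ?r \<otimes> s = s" using inversion_mult[of s v "s \<otimes> ?r \<otimes> s"] s vc rc by simp
  then have "?r = s"
    using \<open>s \<otimes> (s \<otimes> ?r \<otimes> s) \<otimes> s = ?r\<close> s by (simp add: involution)
  then have "s \<otimes> v = ?r \<otimes> v" by simp
  also have "\<dots> = v \<otimes> t" using vc tS by (simp add: m_assoc)
  finally have "s \<otimes> v = v \<otimes> t" .
  then show ?thesis using swap t by blast
qed (use rep in blast)

text \<open>The reflection v s v^-1 is not an inversion of \<open>v\<close>, and \<open>s\<close> is
  a left descent of \<open>x \<otimes> inv v\<close> because lengths add. So this reflection is an
  inversion of the conjugate of \<open>x\<close>, and multiplying by it removes
  \<open>s\<close>.\<close>

lemma reps_conj_less:
  assumes I: "I \<subseteq> S" and v: "v \<in> reps I" and x: "x \<in> generate W I"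
    and s: "s \<in> I" and less: "\<ell> (s \<otimes> x) < \<ell> x"
  shows "\<ell> (v \<otimes> (s \<otimes> x) \<otimes> inv v) < \<ell> (v \<otimes> x \<otimes> inv v)"
proof -
  have c: "v \<in> carrier W" "x \<in> carrier W" "s \<in> S" using assms repsD(1) by auto
  let ?t = "v \<otimes> s \<otimes> inv v"
  have tc: "?t \<in> carrier W" using c by simp
  have "\<not> inversion v ?t" using right_less_iff(2)[of v s] c repsD(2)[OF v s] by simp
  moreover have "inversion (x \<otimes> inv v) s"
  proof -
    have l: "\<ell> (y \<otimes> inv v) = \<ell> v + \<ell> y" if y: "y \<in> generate W I" for y
    proof -
      have "\<ell> (y \<otimes> inv v) = \<ell> (inv (y \<otimes> inv v))" using y I c len_inv[of "y \<otimes> inv v"] by simp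
      also have "inv (y \<otimes> inv v) = v \<otimes> inv y" using y I c by (simp add: inv_mult_group)
      finally show ?thesis using reps_len_mult[OF I v, of "inv y"] y I by simp
    qed
    have "\<ell> (s \<otimes> (x \<otimes> inv v)) < \<ell> (x \<otimes> inv v)"
      using l[OF x] l[of "s \<otimes> x"] less x s c by (simp add: m_assoc)
    then show ?thesis using left_less_iff(1)[of "x \<otimes> inv v" s] c by simp
  qed
  moreover have "inv v \<otimes> ?t \<otimes> v = s" using conj_iff[of v ?t s] c tc by simp
  ultimately have "inversion (v \<otimes> (x \<otimes> inv v)) ?t"
    using inversion_mult[of v "x \<otimes> inv v" ?t] c tc by simp
  then have "\<ell> (?t \<otimes> (v \<otimes> (x \<otimes> inv v))) < \<ell> (v \<otimes> (x \<otimes> inv v))"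
    using reflection_less_iff(1)[of "v \<otimes> (x \<otimes> inv v)" v s] c by simp
  moreover have "?t \<otimes> (v \<otimes> (x \<otimes> inv v)) = v \<otimes> (s \<otimes> x) \<otimes> inv v"
    using c by (simp add: m_assoc)
  ultimately show ?thesis using c by (simp add: m_assoc)
qed

text \<open>Along a reduced word of \<open>x\<close>, removing letters from the left only shortens the conjugate by
  \<open>v\<close>; consecutive truncations differ by the conjugate of a letter.\<close>
lemma reps_conj_word:
  assumes I: "I \<subseteq> S" and v: "v \<in> reps I"
  shows "\<lbrakk>reduced xs; xs \<in> lists I\<rbrakk> \<Longrightarrow>
    length xs \<le> \<ell> (v \<otimes> \<pi> xs \<otimes> inv v) \<and>
    (\<forall>s\<in>set xs. \<ell> (v \<otimes> s \<otimes> inv v) \<le> 2 * \<ell> (v \<otimes> \<pi> xs \<otimes> inv v))"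
proof (induction xs)
  case (Cons s xs)
  have c: "v \<in> carrier W" using v repsD(1) by blast
  note d = reduced_ConsD[OF Cons.prems(1)]
  have s: "s \<in> I" "xs \<in> lists I" using Cons.prems by auto
  let ?x = "v \<otimes> \<pi> xs \<otimes> inv v" and ?sx = "v \<otimes> \<pi> (s # xs) \<otimes> inv v"
  have "\<pi> (s # xs) \<in> generate W I" using word_generate I Cons.prems by blast
  moreover have "\<ell> (s \<otimes> \<pi> (s # xs)) < \<ell> (\<pi> (s # xs))" using d by simp
  ultimately have less: "\<ell> ?x < \<ell> ?sx"
    using reps_conj_less[OF I v _ s(1), of "\<pi> (s # xs)"] d by simp
  have "?sx \<otimes> inv ?x = v \<otimes> s \<otimes> inv v"
    using c d by (simp add: m_assoc inv_mult_group)
  then have "\<ell> (v \<otimes> s \<otimes> inv v) \<le> \<ell> ?sx + \<ell> ?x"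
    using len_mult_le[of ?sx "inv ?x"] c d by simp
  with less Cons.IH[OF d(1) s(2)] show ?case by auto
qed simp

lemma reps_conj_len:
  assumes "I \<subseteq> S" "v \<in> reps I" "x \<in> generate W I"
  shows "\<ell> x \<le> \<ell> (v \<otimes> x \<otimes> inv v)"
proof -
  obtain xs where "reduced xs" "xs \<in> lists I" "\<pi> xs = x" using generate_ex_reduced assms by metis
  then show ?thesis using reps_conj_word[OF assms(1,2), of xs] by (simp add: reduced_def)
qed

section \<open>Minimal double coset representatives and Kilmoyer's theorem\<close>

definition double_reps :: "'a set \<Rightarrow> 'a set \<Rightarrow> 'a set" where
  "double_reps K I = {b \<in> reps I. inv b \<in> reps K}"

lemma double_reps_left:
  assumes "b \<in> double_reps K I" "K \<subseteq> S" "s \<in> K"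
  shows "\<ell> b < \<ell> (s \<otimes> b)"
proof -
  have c: "b \<in> carrier W" "s \<in> S" using assms repsD(1) by (auto simp: double_reps_def)
  have "\<ell> (inv b) < \<ell> (inv b \<otimes> s)" using assms repsD(2) by (auto simp: double_reps_def)
  also have "inv b \<otimes> s = inv (s \<otimes> b)" using c by (simp add: inv_mult_group)
  finally show ?thesis using c by simp
qed

text \<open>Splitting off the W_K-part of \<open>v\<close> on the left keeps the rest in W^I:
  lengths add in this factorization, so any right descent of the rest in \<open>I\<close> would be
  one of \<open>v\<close>.\<close>

lemma ex_double_reps:
  assumes I: "I \<subseteq> S" and K: "K \<subseteq> S" and v: "v \<in> reps I"
  obtains a b where "a \<in> generate W K" "b \<in> double_reps K I" "v = a \<otimes> b"
proof -
  have vc: "v \<in> carrier W" using v repsD by blast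
  obtain c a where ca: "c \<in> reps K" "a \<in> generate W K" "inv v = c \<otimes> a"
    using ex_reps[OF K, of "inv v"] vc by auto
  have c: "c \<in> carrier W" "a \<in> carrier W" using ca K repsD(1) by auto
  have v_eq: "v = inv a \<otimes> inv c" using ca(3) vc c by (metis inv_inv inv_mult_group)
  have len_v: "\<ell> v = \<ell> c + \<ell> a" using reps_len_mult[OF K ca(1,2)] ca(3) vc by (metis len_inv)
  have "\<ell> (inv c) < \<ell> (inv c \<otimes> t)" if t: "t \<in> I" for t
  proof -
    have tS: "t \<in> S" using t I by blast
    have "\<ell> c + \<ell> a < \<ell> (v \<otimes> t)" using repsD(2)[OF v t] len_v by simp
    also have "v \<otimes> t = inv a \<otimes> (inv c \<otimes> t)" using v_eq c tS by (simp add: m_assoc)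
    also have "\<ell> \<dots> \<le> \<ell> a + \<ell> (inv c \<otimes> t)" using len_mult_le[of "inv a" "inv c \<otimes> t"] c tS by simp
    finally show ?thesis using c by simp
  qed
  then have "inv c \<in> double_reps K I" using c ca(1) by (simp add: double_reps_def min_coset_reps_def)
  then show ?thesis using that[of "inv a" "inv c"] v_eq ca K by simp
qed

text \<open>Kilmoyer's theorem \<open>b\<^sup>-\<^sup>1 W\<^sub>K b \<inter> W\<^sub>I = W\<^sub>L\<close> with \<open>L = I \<inter> b\<^sup>-\<^sup>1 K b\<close>.\<close>
lemma double_reps_intersection:
  assumes I: "I \<subseteq> S" and K: "K \<subseteq> S" and b: "b \<in> double_reps K I"
  shows "\<lbrakk>reduced xs; xs \<in> lists K; y \<in> generate W I; \<pi> xs \<otimes> b = b \<otimes> y\<rbrakk> \<Longrightarrow>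
    y \<in> generate W {t \<in> I. b \<otimes> t \<otimes> inv b \<in> K}"
proof (induction xs arbitrary: y)
  case Nil
  have "b \<in> carrier W" "y \<in> carrier W" using b Nil I repsD(1) by (auto simp: double_reps_def)
  then have "y = \<one>" using Nil by simp
  then show ?case by simp
next
  case (Cons s xs)
  have br: "b \<in> reps I" using b by (simp add: double_reps_def)
  have c: "b \<in> carrier W" "y \<in> carrier W" using br Cons I repsD(1) by auto
  note d = reduced_ConsD[OF Cons.prems(1)]
  have s: "s \<in> K" "xs \<in> lists K" using Cons.prems by auto
  have e: "s \<otimes> (b \<otimes> y) = \<pi> xs \<otimes> b" using Cons.prems(4)[symmetric] c d by (simp add: m_assoc)
  have up: "\<ell> b < \<ell> (s \<otimes> b)" using double_reps_left b K s by blast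
  have len_left: "\<ell> (z \<otimes> b) = \<ell> b + \<ell> z" if z: "z \<in> generate W K" for z
  proof -
    have zc: "z \<in> carrier W" using z K by simp
    have "\<ell> (inv b \<otimes> inv z) = \<ell> b + \<ell> z"
      using reps_len_mult[OF K, of "inv b" "inv z"] b z K c by (simp add: double_reps_def)
    then show ?thesis using len_inv[of "z \<otimes> b"] zc c by (simp add: inv_mult_group)
  qed
  have xK: "\<pi> xs \<in> generate W K" "\<pi> (s # xs) \<in> generate W K"
    using word_generate K Cons.prems s by blast+
  have "\<ell> (s \<otimes> (b \<otimes> y)) < \<ell> (b \<otimes> y)"
    using len_left[OF xK(1)] len_left[OF xK(2)] e d(4) Cons.prems(4) by simp
  moreover have "\<ell> (b \<otimes> y) = \<ell> b + \<ell> y" using reps_len_mult[OF I br] Cons.prems by blast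
  \<comment> \<open>If \<open>s \<otimes> b\<close> were in W^I, its length would also add to that
    of \<open>y\<close>. But \<open>s\<close> lengthens \<open>b\<close> and shortens
    \<open>b \<otimes> y\<close>.\<close>
  ultimately have "s \<otimes> b \<notin> reps I"
    using reps_len_mult[OF I, of "s \<otimes> b" y] up Cons.prems c d(2) by (auto simp: m_assoc)
  then obtain t where t: "t \<in> I" "s \<otimes> b = b \<otimes> t" using deodhar[OF I br d(2)] by blast
  have tS: "t \<in> S" using t I by blast
  have "b \<otimes> t \<otimes> inv b = s" using t(2)[symmetric] c d(2) by (simp add: m_assoc)
  then have tL: "t \<in> {t \<in> I. b \<otimes> t \<otimes> inv b \<in> K}" using t s by simp
  have "\<pi> xs \<otimes> b = b \<otimes> (t \<otimes> y)"
    using e t(2) c d(2) tS by (metis m_assoc S_carrier)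
  then have "t \<otimes> y \<in> generate W {t \<in> I. b \<otimes> t \<otimes> inv b \<in> K}"
    using Cons.IH[OF d(1) s(2), of "t \<otimes> y"] Cons.prems t by simp
  then have "t \<otimes> (t \<otimes> y) \<in> generate W {t \<in> I. b \<otimes> t \<otimes> inv b \<in> K}"
    by (rule generate_mult[OF generate_incl[OF tL]])
  then show ?case unfolding S_cancel[OF tS c(2)] .
qed

section \<open>Conjugates of parabolic subgroups\<close>

abbreviation cj :: "'a \<Rightarrow> 'a \<Rightarrow> 'a" where "cj g x \<equiv> g \<otimes> x \<otimes> inv g"

lemma cj_mult:
  "\<lbrakk>g \<in> carrier W; h \<in> carrier W; x \<in> carrier W\<rbrakk> \<Longrightarrow> cj (g \<otimes> h) x = cj g (cj h x)"
  by (simp add: m_assoc inv_mult_group)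

lemma cj_inv_cancel [simp]:
  "\<lbrakk>g \<in> carrier W; x \<in> carrier W\<rbrakk> \<Longrightarrow> inv g \<otimes> cj g x \<otimes> g = x"
  "\<lbrakk>g \<in> carrier W; x \<in> carrier W\<rbrakk> \<Longrightarrow> cj (inv g) (cj g x) = x"
  "\<lbrakk>g \<in> carrier W; x \<in> carrier W\<rbrakk> \<Longrightarrow> cj g (inv g \<otimes> x \<otimes> g) = x"
  by (simp_all add: m_assoc)

lemma inj_on_cj: "g \<in> carrier W \<Longrightarrow> A \<subseteq> carrier W \<Longrightarrow> inj_on (cj g) A"
  by (intro inj_onI) (simp add: subset_iff)

lemma conj_set_eq: "g <# K #> inv g = cj g ` K"
  by (auto simp: l_coset_def r_coset_def image_def)

lemma conj_under_iff: "conj_under W H J K \<longleftrightarrow> (\<exists>g\<in>H. K = cj g ` J)"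
  by (simp add: conj_under_def conj_set_eq)

lemma cj_generate:
  assumes "g \<in> carrier W" "K \<subseteq> carrier W"
  shows "cj g ` generate W K = generate W (cj g ` K)"
proof -
  have "cj g \<in> hom W W" using assms by (intro homI) (simp_all add: m_assoc)
  then interpret group_hom W W "cj g" by unfold_locales
  show ?thesis using generate_img assms by simp
qed

lemma normalizer_iff:
  assumes "K \<subseteq> S"
  shows "g \<in> normalizer W (generate W K) \<longleftrightarrow>
    g \<in> carrier W \<and> generate W (cj g ` K) = generate W K"
proof -
  have "K \<subseteq> carrier W" "generate W K \<subseteq> carrier W" using assms S_subset generate_closed by auto
  then show ?thesis
    unfolding normalizer_def stabilizer_def
    by (simp add: conj_set_eq cj_generate cong: conj_cong)
qed

lemma generate_le_normalizer:
  assumes "K \<subseteq> S"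
  shows "generate W K \<subseteq> normalizer W (generate W K)"
proof
  fix g assume g: "g \<in> generate W K"
  have c: "g \<in> carrier W" "K \<subseteq> carrier W" using g assms S_subset by auto
  have "cj g ` generate W K = generate W K"
  proof
    show "cj g ` generate W K \<subseteq> generate W K" using g assms by auto
    show "generate W K \<subseteq> cj g ` generate W K"
    proof
      fix x assume x: "x \<in> generate W K"
      then have "x = cj g (cj (inv g) x)" using c assms by simp
      moreover have "cj (inv g) x \<in> generate W K" using x g assms by simp
      ultimately show "x \<in> cj g ` generate W K" by (rule image_eqI)
    qed
  qed
  then show "g \<in> normalizer W (generate W K)"
    using c assms by (simp add: normalizer_iff cj_generate)
qed

lemma generate_subset_generate:
  assumes "I \<subseteq> S" "K \<subseteq> generate W I"
  shows "generate W K \<subseteq> generate W I"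
  using assms generate_subgroup_incl generate_is_subgroup S_subset by auto

text \<open>An element of the set is determined by its conjugation map on \<open>K\<close>, and this
  map takes values in a finite ball.\<close>

lemma finite_reps_conj:
  assumes I: "I \<subseteq> S" and J: "J \<subseteq> I" and N: "normalizer W (generate W J) \<subseteq> generate W I"
    and K: "K \<subseteq> S" "conj_under W (generate W I) J K"
  shows "finite {v \<in> reps I. \<forall>k\<in>K. \<ell> (cj v k) \<le> n}" (is "finite ?A")
proof (rule inj_on_finite)
  let ?m = "\<lambda>v. restrict (cj v) K"
  from K obtain g where g: "g \<in> generate W I" "K = cj g ` J" by (auto simp: conj_under_iff)
  have gc: "g \<in> carrier W" using g I by simp
  show "?m ` ?A \<subseteq> K \<rightarrow>\<^sub>E {w \<in> carrier W. \<ell> w \<le> n}"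
    using K repsD(1) by (auto intro!: m_closed)
  show "finite (K \<rightarrow>\<^sub>E {w \<in> carrier W. \<ell> w \<le> n})"
    using K(1) finite_S finite_subset finite_ball by (intro finite_PiE) auto
  show "inj_on ?m ?A"
  proof (rule inj_onI)
    fix v v' assume v: "v \<in> ?A" "v' \<in> ?A" and eq: "?m v = ?m v'"
    have c: "v \<in> carrier W" "v' \<in> carrier W" using v repsD(1) by auto
    define h where "h = inv v' \<otimes> v"
    have h: "h \<in> carrier W" using c by (simp add: h_def)
    have hk: "cj h k = k" if "k \<in> K" for k
    proof -
      have kc: "k \<in> carrier W" using that K by auto
      have "cj v k = cj v' k" using fun_cong[OF eq, of k] that by simp
      then have "cj h k = cj (inv v') (cj v' k)" using c kc by (simp add: h_def cj_mult)
      then show ?thesis using c kc by simp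
    qed
    \<comment> \<open>\<open>h\<close> centralizes \<open>K\<close>. Moving it back by
      \<open>g\<close> gives an element centralizing \<open>J\<close>, to which the hypothesis on
      the normalizer of W_J applies.\<close>
    let ?h = "inv g \<otimes> h \<otimes> g"
    have "cj ?h j = j" if "j \<in> J" for j
    proof -
      have jc: "j \<in> carrier W" using that J I by auto
      have "cj ?h j = cj (inv g) (cj h (cj g j))" using gc h jc by (simp add: cj_mult)
      also have "cj h (cj g j) = cj g j" using hk g that by blast
      finally show ?thesis using gc jc by simp
    qed
    then have "cj ?h ` J = J" by simp
    then have "?h \<in> normalizer W (generate W J)"
      using normalizer_iff[of J ?h] J I gc h by simp
    then have "g \<otimes> ?h \<otimes> inv g \<in> generate W I" using N g I by auto
    then have hI: "h \<in> generate W I" using gc h by (simp add: m_assoc)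
    have "v \<otimes> \<one> = v' \<otimes> h" using c by (simp add: h_def)
    then show "v = v'" using reps_unique(1)[OF I, of v v' \<one> h] v hI by simp
  qed
qed

text \<open>The vanishing hypothesis on the form in contrapositive shape. The predicate stands for
  \<open>f (T y) \<noteq> 0\<close>, so that the Coxeter-theoretic part does not mention the Hecke
  algebra.\<close>

definition support_above :: "'a set \<Rightarrow> 'a set \<Rightarrow> ('a \<Rightarrow> bool) \<Rightarrow> bool" where
  "support_above I J P \<longleftrightarrow> (\<forall>J'\<subseteq>I. \<forall>y\<in>generate W J'. P y \<longrightarrow>
    (\<exists>K\<subseteq>J'. conj_under W (generate W I) J K))"

lemma support_aboveD:
  "\<lbrakk>support_above I J P; J' \<subseteq> I; y \<in> generate W J'; P y\<rbrakk> \<Longrightarrow>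
    \<exists>K\<subseteq>J'. conj_under W (generate W I) J K"
  unfolding support_above_def by blast

text \<open>The letters of a reduced word of \<open>y\<close> contain one of finitely many
  conjugates of \<open>J\<close>. \<open>reps_conj_word\<close> bounds the conjugates of these
  letters by \<open>2 * n\<close>, which reduces the claim to
  \<open>finite_reps_conj\<close>.\<close>

lemma finite_reps_supported:
  assumes I: "I \<subseteq> S" and J: "J \<subseteq> I" and N: "normalizer W (generate W J) \<subseteq> generate W I"
    and supp: "support_above I J P"
  shows "finite {v \<in> reps I. \<exists>y\<in>generate W I. P y \<and> \<ell> (cj v y) \<le> n}" (is "finite ?A")
proof (rule finite_subset)
  let ?\<K> = "{K. K \<subseteq> I \<and> conj_under W (generate W I) J K}"
  show "?A \<subseteq> (\<Union>K\<in>?\<K>. {v \<in> reps I. \<forall>k\<in>K. \<ell> (cj v k) \<le> 2 * n})"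
  proof
    fix v assume "v \<in> ?A"
    then obtain y where v: "v \<in> reps I" and y: "y \<in> generate W I" "P y" "\<ell> (cj v y) \<le> n"
      by blast
    obtain xs where xs: "reduced xs" "xs \<in> lists I" "\<pi> xs = y"
      using generate_ex_reduced I y by blast
    have setI: "set xs \<subseteq> I" and "xs \<in> lists (set xs)" using xs by auto
    then have "y \<in> generate W (set xs)"
      using word_generate[of "set xs" xs] xs I by auto
    then obtain K where K: "K \<subseteq> set xs" "conj_under W (generate W I) J K"
      using support_aboveD[OF supp setI] y by blast
    have "\<ell> (cj v k) \<le> 2 * n" if "k \<in> K" for k
      using reps_conj_word[OF I v xs(1,2)] xs(3) K that y by fastforce
    then show "v \<in> (\<Union>K\<in>?\<K>. {v \<in> reps I. \<forall>k\<in>K. \<ell> (cj v k) \<le> 2 * n})"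
      using K setI v by blast
  qed
  have "finite ?\<K>"
    using finite_subset[OF I finite_S] by (intro finite_subset[of ?\<K> "Pow I"]) auto
  then show "finite (\<Union>K\<in>?\<K>. {v \<in> reps I. \<forall>k\<in>K. \<ell> (cj v k) \<le> 2 * n})"
    using finite_reps_conj[OF I J N] I by auto
qed

lemma conj_under_trans:
  assumes "I \<subseteq> S" "J \<subseteq> S" "conj_under W (generate W I) J K" "b \<in> carrier W"
  shows "conj_under W (carrier W) J (cj b ` K)"
proof -
  obtain g where g: "g \<in> generate W I" "K = cj g ` J" using assms by (auto simp: conj_under_iff)
  have "cj b ` K = cj (b \<otimes> g) ` J"
    unfolding g(2) image_image using assms g by (intro image_cong) (auto simp: cj_mult subset_iff)
  then show ?thesis using assms g by (auto simp: conj_under_iff)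
qed

text \<open>The factor \<open>a\<close> in W_K can be conjugated away without leaving W_K.
  Kilmoyer's theorem then places \<open>y\<close> in the parabolic subgroup of those letters of
  \<open>I\<close> that \<open>b\<close> conjugates into \<open>K\<close>, and the support condition
  finds \<open>J'\<close> among them.\<close>

lemma reps_conj_parabolic:
  assumes I: "I \<subseteq> S" and K: "K \<subseteq> S" and J: "J \<subseteq> I"
    and supp: "support_above I J P"
    and v: "v \<in> reps I" and y: "y \<in> generate W I" "P y" and x: "cj v y \<in> generate W K"
  obtains a b J' where "a \<in> generate W K" "b \<in> double_reps K I" "v = a \<otimes> b"
    "J' \<subseteq> I" "conj_under W (generate W I) J J'" "cj b ` J' \<subseteq> K"
proof -
  obtain a b where ab: "a \<in> generate W K" "b \<in> double_reps K I" "v = a \<otimes> b"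
    using ex_double_reps I K v by blast
  have c: "a \<in> carrier W" "b \<in> carrier W" "y \<in> carrier W"
    using ab K I y repsD(1) by (auto simp: double_reps_def)
  let ?z = "cj (inv a) (cj v y)"
  have z: "?z \<in> generate W K" using x ab(1) K by simp
  have "?z = cj b y" using ab(3) c by (simp add: cj_mult)
  then have zb: "?z \<otimes> b = b \<otimes> y" using c by (simp add: m_assoc)
  obtain xs where xs: "reduced xs" "xs \<in> lists K" "\<pi> xs = ?z"
    using generate_ex_reduced K z by blast
  let ?L = "{t \<in> I. cj b t \<in> K}"
  have "y \<in> generate W ?L"
    using double_reps_intersection[OF I K ab(2) xs(1,2) y(1)] xs(3) zb by simp
  then obtain J' where "J' \<subseteq> ?L" "conj_under W (generate W I) J J'"
    using support_aboveD[OF supp, of ?L y] y by blast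
  then show ?thesis using that[OF ab, of J'] by blast
qed

text \<open>The elementary steps of Deodhar's algorithm for conjugating parabolic subgroups: \<open>b\<close> is
  factored through \<open>W\<^sub>L\<close> with \<open>L = K \<union> {s}\<close>, where \<open>s\<close> is a right descent of \<open>b\<close>.\<close>
lemma rep_conj_mem:
  assumes I: "I \<subseteq> S"
    and N: "\<And>K. \<lbrakk>K \<subseteq> S; conj_under W (carrier W) J K\<rbrakk> \<Longrightarrow>
      normalizer W (generate W K) \<subseteq> generate W I" and J: "J \<subseteq> S"
  shows "\<lbrakk>b \<in> reps K; K \<subseteq> S; conj_under W (carrier W) J K; cj b ` K \<subseteq> S\<rbrakk> \<Longrightarrow>
    b \<in> generate W I"
proof (induction "\<ell> b" arbitrary: b K rule: less_induct)
  case less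
  have bc: "b \<in> carrier W" using less.prems repsD(1) by blast
  show ?case
  proof (cases "b \<in> reps S")
    case True
    then have "b = \<one>" using reps_generate[of S b] generated bc by simp
    then show ?thesis by simp
  next
    case False
    then obtain s where s: "s \<in> S" "\<not> \<ell> b < \<ell> (b \<otimes> s)" using bc by (auto simp: min_coset_reps_def)
    let ?L = "insert s K"
    have L: "?L \<subseteq> S" using s less.prems by simp
    obtain b' u where bu: "b' \<in> reps ?L" "u \<in> generate W ?L" "b = b' \<otimes> u"
      using ex_reps[OF L bc] by blast
    have c: "b' \<in> carrier W" "u \<in> carrier W"
      using repsD(1)[OF bu(1)] generate_closed[OF L bu(2)] by auto
    \<comment> \<open>The descent \<open>s\<close> of \<open>b\<close> belongs to \<open>?L\<close>,
      so \<open>b\<close> is not minimal in its coset. This makes \<open>b'\<close> shorter and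
      available to the induction.\<close>
    have "u \<noteq> \<one>"
    proof
      assume "u = \<one>"
      then have "b \<in> reps ?L" using bu c by simp
      then show False using repsD(2)[of b ?L s] s by simp
    qed
    then have less': "\<ell> b' < \<ell> b" using reps_len_mult[OF L bu(1,2)] len_eq_0D[of u] bu(3) c by auto
    \<comment> \<open>Deodhar's alternative for \<open>k1\<close> and \<open>b'\<close>: since k1 b'
      u = b' u k stays in the coset of \<open>b'\<close>, the letter \<open>k1\<close> must pass
      through \<open>b'\<close> and become a letter of \<open>?L\<close>.\<close>
    have uK: "cj u k \<in> ?L" if k: "k \<in> K" for k
    proof -
      have kS: "k \<in> S" using k less.prems by blast
      define k1 where "k1 = cj b k"
      have k1: "k1 \<in> S" using k less.prems by (auto simp: k1_def)
      have eq: "k1 \<otimes> b' \<otimes> u = b' \<otimes> (u \<otimes> k)"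
        using kS c by (simp add: k1_def bu(3) m_assoc inv_mult_group)
      from L bu(1) k1 show ?thesis
      proof (cases rule: deodhar)
        case rep
        have "k1 \<otimes> b' = b'"
          using reps_unique(1)[OF L rep bu(1,2) _ eq] bu(2) k by simp
        then have "k1 = \<one>" using c k1 by simp
        then show ?thesis using not_one k1 by blast
      next
        case (swap t)
        then have tS: "t \<in> S" using L by blast
        have "b' \<otimes> (t \<otimes> u) = b' \<otimes> (u \<otimes> k)" using eq swap(2) c tS by (simp add: m_assoc)
        then have "t \<otimes> u = u \<otimes> k" using c tS kS by simp
        then have "cj u k = t" using c tS by (simp add: m_assoc flip: \<open>t \<otimes> u = u \<otimes> k\<close>)
        then show ?thesis using swap by simp
      qed
    qed
    let ?K' = "cj u ` K"
    have K': "?K' \<subseteq> ?L" using uK by blast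
    have Kc: "K \<subseteq> carrier W" using less.prems by auto
    have "cj b' ` ?K' = cj b ` K"
      unfolding image_image bu(3) using c Kc by (intro image_cong) (auto simp: cj_mult)
    moreover have cu: "conj_under W (carrier W) J ?K'"
      using conj_under_trans[of S J K u] generated J less.prems c by simp
    moreover have K'S: "?K' \<subseteq> S" using K' L by blast
    moreover have "b' \<in> reps ?K'" using bu(1) K' reps_antimono by blast
    ultimately have b'I: "b' \<in> generate W I"
      using less.hyps[OF less'] less.prems(4) by simp
    note NK = N[OF less.prems(2,3)]
    \<comment> \<open>Either \<open>u\<close> normalizes W_K, or \<open>?K'\<close> differs from
      \<open>K\<close>. In the second case the equal cardinalities force \<open>s\<close> into
      \<open>?K'\<close>, so both \<open>s\<close> and \<open>K\<close> lie in W_I, and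
      \<open>u\<close> does too.\<close>
    have "u \<in> generate W I"
    proof (cases "?K' = K")
      case True
      then have "u \<in> normalizer W (generate W K)" using normalizer_iff c less.prems by simp
      then show ?thesis using NK by blast
    next
      case False
      have fin: "finite K" using less.prems finite_S finite_subset by blast
      have "card ?K' = card K" using inj_on_cj c Kc by (intro card_image) auto
      then have "s \<in> ?K'" using False K' fin card_subset_eq[of K ?K'] by blast
      moreover have "?K' \<subseteq> generate W I"
        using N[OF K'S cu] generate_le_normalizer[OF K'S] generate_incl by blast
      moreover have "K \<subseteq> generate W I"
        using NK generate_le_normalizer[OF less.prems(2)] generate_incl by blast
      ultimately have "?L \<subseteq> generate W I" by blast
      then show ?thesis using generate_subset_generate[OF I] bu(2) by blast
    qed
    then show ?thesis using bu(3) b'I by simp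
  qed
qed

text \<open>The double coset representative \<open>b\<close> of \<open>v\<close> conjugates a
  conjugate of \<open>J\<close> in \<open>I\<close> into \<open>I\<close>, so it lies in W_I by
  \<open>rep_conj_mem\<close>. Then \<open>v\<close> lies in W_I, which meets W^I only in the
  identity.\<close>

lemma reps_conj_generate_eq_one:
  assumes I: "I \<subseteq> S" and J: "J \<subseteq> I"
    and supp: "support_above I J P"
    and N: "\<And>K. \<lbrakk>K \<subseteq> S; conj_under W (carrier W) J K\<rbrakk> \<Longrightarrow>
      normalizer W (generate W K) \<subseteq> generate W I"
    and v: "v \<in> reps I" and y: "y \<in> generate W I" "P y" and x: "cj v y \<in> generate W I"
  shows "v = \<one>"
proof -
  obtain a b J' where ab: "a \<in> generate W I" "b \<in> double_reps I I" "v = a \<otimes> b"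
    and J': "J' \<subseteq> I" "conj_under W (generate W I) J J'" "cj b ` J' \<subseteq> I"
    using reps_conj_parabolic[OF I I J supp v y x] by blast
  have b: "b \<in> reps I" "b \<in> carrier W" using ab repsD(1) by (auto simp: double_reps_def)
  have "conj_under W (carrier W) J (cj \<one> ` J')"
    using conj_under_trans[OF I _ J'(2) one_closed] J I by simp
  moreover have "cj \<one> ` J' = J'"
  proof -
    have "J' \<subseteq> carrier W" using J' I S_subset by blast
    then have "cj \<one> ` J' = (\<lambda>x. x) ` J'" by (intro image_cong) auto
    then show ?thesis by simp
  qed
  ultimately have cu: "conj_under W (carrier W) J J'" by simp
  have "b \<in> generate W I"
  proof (rule rep_conj_mem[of I J b J'])
    show "b \<in> reps J'" using b reps_antimono[OF J'(1)] by blast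
    show "normalizer W (generate W K) \<subseteq> generate W I"
      if "K \<subseteq> S" "conj_under W (carrier W) J K" for K
      using N that .
  qed (use J' J I cu in auto)
  then have "v \<in> generate W I" using ab by simp
  then show ?thesis using reps_generate I v by blast
qed

section \<open>Conjugacy classes of parabolic subgroups\<close>

definition cl :: "'a set \<Rightarrow> 'a \<Rightarrow> 'a set" where
  "cl I x = (\<lambda>g. cj g x) ` generate W I"

lemma conj_classes_eq: "conj_classes W (generate W I) = cl I ` generate W I"
proof -
  have "cl I x = {cj g x | g. g \<in> generate W I}" for x by (auto simp: cl_def)
  then show ?thesis by (simp add: conj_classes_def)
qed

lemma cl_self: "I \<subseteq> S \<Longrightarrow> x \<in> generate W I \<Longrightarrow> x \<in> cl I x"
  unfolding cl_def by (rule image_eqI[of _ _ \<one>]) auto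

lemma cl_eq:
  assumes I: "I \<subseteq> S" and x: "x \<in> generate W I" and y: "y \<in> cl I x"
  shows "cl I y = cl I x"
proof -
  have sub: "cl I (cj g x) \<subseteq> cl I x" if "g \<in> generate W I" "x \<in> generate W I" for g x
  proof
    fix z assume "z \<in> cl I (cj g x)"
    then obtain h where "h \<in> generate W I" "z = cj h (cj g x)" unfolding cl_def by blast
    moreover from this that I have "cj h (cj g x) = cj (h \<otimes> g) x" by (simp add: cj_mult)
    ultimately show "z \<in> cl I x" using that unfolding cl_def by (auto intro!: image_eqI)
  qed
  from y obtain g where g: "g \<in> generate W I" "y = cj g x" unfolding cl_def by blast
  have "cj (inv g) y = x" using g x I by simp
  then have "cl I x \<subseteq> cl I y" using sub[of "inv g" y] g x I by simp
  then show ?thesis using sub[of g x] g x by simp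
qed

lemma conj_classD:
  assumes I: "I \<subseteq> S" and C: "C \<in> conj_classes W (generate W I)"
  shows "x \<in> C \<Longrightarrow> x \<in> generate W I" "x \<in> C \<Longrightarrow> C = cl I x"
    "x \<in> C \<Longrightarrow> g \<in> generate W I \<Longrightarrow> cj g x \<in> C"
    "x \<in> C \<Longrightarrow> y \<in> C \<Longrightarrow> \<exists>g\<in>generate W I. y = cj g x"
    "C \<noteq> {}"
proof -
  obtain z where z: "z \<in> generate W I" "C = cl I z" using C conj_classes_eq by blast
  show gen: "x \<in> generate W I" if "x \<in> C" for x using that z I by (auto simp: cl_def)
  show eq: "C = cl I x" if "x \<in> C" for x using cl_eq that z I by blast
  show "cj g x \<in> C" if "x \<in> C" "g \<in> generate W I"
    using that(2) unfolding eq[OF that(1)] cl_def by blast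
  show "\<exists>g\<in>generate W I. y = cj g x" if "x \<in> C" "y \<in> C"
    using that(2) unfolding eq[OF that(1)] cl_def by blast
  show "C \<noteq> {}" using z cl_self I by blast
qed

lemma cl_conj_class:
  "x \<in> generate W I \<Longrightarrow> cl I x \<in> conj_classes W (generate W I)"
  by (simp add: conj_classes_eq)

text \<open>Conjugation by an element of \<open>W\<^sup>I\<close> does not decrease the length, so every class of \<open>W\<^sub>I\<close>
  inside the class of \<open>w\<close> has an element of length at most \<open>\<ell> w\<close>.\<close>
lemma finite_subclasses:
  assumes I: "I \<subseteq> S" and C: "C \<in> conj_classes W (carrier W)"
  shows "finite {C' \<in> conj_classes W (generate W I). C' \<subseteq> C}" (is "finite ?\<C>")
proof -
  note CD = conj_classD[OF subset_refl, of C, unfolded generated, OF C]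
  obtain w where w: "w \<in> C" using CD(5) by blast
  have "C' \<in> cl I ` {y \<in> carrier W. \<ell> y \<le> \<ell> w}" if C': "C' \<in> ?\<C>" for C'
  proof -
    have C'I: "C' \<in> conj_classes W (generate W I)" using C' by blast
    note C'D = conj_classD[OF I C'I]
    obtain y where y: "y \<in> C'" using C'D(5) by blast
    then obtain g where g: "g \<in> carrier W" "w = cj g y" using CD(4)[of y w] C' w by blast
    obtain v x where vx: "v \<in> reps I" "x \<in> generate W I" "g = v \<otimes> x" using ex_reps[OF I g(1)] .
    have yI: "y \<in> generate W I" using C'D(1) y .
    have y': "cj x y \<in> C'" using C'D(3) y vx by blast
    have "w = cj v (cj x y)"
      using g vx yI I repsD(1)[OF vx(1)] by (simp add: cj_mult)
    then have "\<ell> (cj x y) \<le> \<ell> w" using reps_conj_len[OF I vx(1) C'D(1)[OF y']] by simp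
    moreover have "cj x y \<in> carrier W" using C'D(1)[OF y'] I by simp
    ultimately show ?thesis using C'D(2)[OF y'] by blast
  qed
  then have "?\<C> \<subseteq> cl I ` {y \<in> carrier W. \<ell> y \<le> \<ell> w}" by blast
  then show ?thesis using finite_ball finite_surj by blast
qed

section \<open>Counting the cosets fixed by an element\<close>

definition rep_of :: "'a set \<Rightarrow> 'a \<Rightarrow> 'a" where
  "rep_of I g = (SOME v. v \<in> reps I \<and> (\<exists>x\<in>generate W I. g = v \<otimes> x))"

lemma rep_of:
  assumes "I \<subseteq> S" "g \<in> carrier W"
  shows "rep_of I g \<in> reps I" "\<exists>x\<in>generate W I. g = rep_of I g \<otimes> x"
proof -
  have "\<exists>v. v \<in> reps I \<and> (\<exists>x\<in>generate W I. g = v \<otimes> x)" using ex_reps[OF assms] by metis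
  from someI_ex[OF this] show "rep_of I g \<in> reps I" "\<exists>x\<in>generate W I. g = rep_of I g \<otimes> x"
    unfolding rep_of_def by blast+
qed

lemma rep_of_mult:
  assumes I: "I \<subseteq> S" and v: "v \<in> reps I" and x: "x \<in> generate W I"
  shows "rep_of I (v \<otimes> x) = v"
proof -
  have "v \<otimes> x \<in> carrier W" using repsD(1)[OF v] x I by simp
  from rep_of[OF I this] show ?thesis using reps_unique(1)[OF I _ v _ x] by metis
qed

text \<open>Indexes the cosets \<open>v W\<^sub>I\<close> fixed by \<open>w\<close> on which \<open>w\<close> acts through the class \<open>C\<close>.\<close>
definition fixed_reps :: "'a set \<Rightarrow> 'a set \<Rightarrow> 'a \<Rightarrow> 'a set" where
  "fixed_reps I C w = {v \<in> reps I. cj (inv v) w \<in> C}"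

text \<open>Left multiplication by \<open>g\<close> carries the cosets fixed by \<open>w\<close> to
  those fixed by its conjugate. Passing to the new minimal representative changes the induced
  element of W_I by an inner conjugation only, so its class \<open>C\<close> is kept.\<close>

lemma fixed_reps_rep_of:
  assumes I: "I \<subseteq> S" and C: "C \<in> conj_classes W (generate W I)"
    and g: "g \<in> carrier W" and w: "w \<in> carrier W" and v: "v \<in> fixed_reps I C w"
  shows "rep_of I (g \<otimes> v) \<in> fixed_reps I C (cj g w)"
    "rep_of I (inv g \<otimes> rep_of I (g \<otimes> v)) = v"
proof -
  have v': "v \<in> reps I" "v \<in> carrier W" "cj (inv v) w \<in> C"
    using v repsD(1) by (auto simp: fixed_reps_def)
  let ?u = "rep_of I (g \<otimes> v)"
  have gv: "g \<otimes> v \<in> carrier W" using g v' by simp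
  obtain x where x: "x \<in> generate W I" "g \<otimes> v = ?u \<otimes> x" using rep_of(2)[OF I gv] by blast
  have c: "?u \<in> carrier W" "x \<in> carrier W" using rep_of(1)[OF I gv] repsD(1) x I by auto
  have u: "?u = g \<otimes> v \<otimes> inv x" using x(2) c gv by (metis inv_solve_right)
  have inv_u: "inv ?u = x \<otimes> (inv v \<otimes> inv g)"
    using g v' c unfolding u by (simp add: inv_mult_group m_assoc)
  have "cj (inv ?u) (cj g w) = cj x (cj (inv v) (cj (inv g) (cj g w)))"
    unfolding inv_u using c(2) v'(2) g w by (simp add: cj_mult)
  also have "cj (inv g) (cj g w) = w" using g w by simp
  finally show "?u \<in> fixed_reps I C (cj g w)"
    using conj_classD(3)[OF I C v'(3) x(1)] rep_of(1)[OF I gv] by (simp add: fixed_reps_def)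
  have "inv g \<otimes> ?u = v \<otimes> inv x" using g v' c(2) unfolding u by (simp add: m_assoc)
  then show "rep_of I (inv g \<otimes> ?u) = v" using rep_of_mult[OF I v'(1)] x(1) I by simp
qed

lemma card_fixed_reps:
  assumes I: "I \<subseteq> S" and C: "C \<in> conj_classes W (generate W I)"
    and g: "g \<in> carrier W" and w: "w \<in> carrier W"
  shows "card (fixed_reps I C (cj g w)) = card (fixed_reps I C w)"
proof -
  note fwd = fixed_reps_rep_of[OF I C g w]
  have gw: "cj g w \<in> carrier W" "inv g \<in> carrier W" "cj (inv g) (cj g w) = w" using g w by auto
  note bwd = fixed_reps_rep_of[OF I C gw(2,1), unfolded gw(3)]
  have "bij_betw (\<lambda>v. rep_of I (g \<otimes> v)) (fixed_reps I C w) (fixed_reps I C (cj g w))"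
    using fwd bwd g
    by (intro bij_betw_byWitness[where f' = "\<lambda>v. rep_of I (inv g \<otimes> v)"]) auto
  then show ?thesis using bij_betw_same_card by metis
qed

text \<open>The number of fixed cosets may be infinite, in which case \<open>card\<close> returns \<open>0\<close>; the value \<open>1\<close>
  is then used, as the form vanishes on such a class modulo \<open>q - 1\<close>.\<close>
definition class_index :: "'a set \<Rightarrow> 'a set \<Rightarrow> int" where
  "class_index I C = (let n = card (fixed_reps I C (SOME w. w \<in> C)) in if n = 0 then 1 else int n)"

lemma class_index_pos: "class_index I C > 0"
  by (simp add: class_index_def Let_def)

lemma class_index_eq:
  assumes I: "I \<subseteq> S" and C': "C' \<in> conj_classes W (generate W I)"
    and C: "C \<in> conj_classes W (carrier W)" "C' \<subseteq> C" "w \<in> C"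
    and fin: "finite (fixed_reps I C' w)"
  shows "class_index I C' = int (card (fixed_reps I C' w))"
proof -
  note CD = conj_classD[OF subset_refl, of C, unfolded generated, OF C(1)]
  note C'D = conj_classD[OF I C']
  define y where "y = (SOME y. y \<in> C')"
  have y: "y \<in> C'" using C'D(5) unfolding y_def by (simp add: some_in_eq)
  then obtain g where g: "g \<in> carrier W" "w = cj g y" using CD(4)[of y w] C by blast
  have yc: "y \<in> carrier W" using C'D(1)[OF y] I by simp
  have card: "card (fixed_reps I C' w) = card (fixed_reps I C' y)"
    unfolding g(2) by (rule card_fixed_reps[OF I C' g(1) yc])
  \<comment> \<open>The identity coset is fixed by \<open>y\<close>. Transported to
    \<open>w\<close>, it shows that the finite count is not 0, which excludes the default value in
    \<open>class_index\<close>.\<close>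
  have "\<one> \<in> fixed_reps I C' y" using y yc I by (simp add: fixed_reps_def)
  then have "rep_of I (g \<otimes> \<one>) \<in> fixed_reps I C' w"
    unfolding g(2) by (rule fixed_reps_rep_of(1)[OF I C' g(1) yc])
  then have "card (fixed_reps I C' w) \<noteq> 0" using fin by auto
  then show ?thesis using card by (simp add: class_index_def Let_def flip: y_def)
qed

end

section \<open>The standard basis of the Hecke algebra\<close>

sublocale hecke_algebra \<subseteq> H: Modules.module scale
  by (rule scale_module)

definition laurent_linear :: "(laurent \<Rightarrow> 'h::ring_1 \<Rightarrow> 'h) \<Rightarrow> ('h \<Rightarrow> laurent) \<Rightarrow> bool" where
  "laurent_linear scale g \<longleftrightarrow>
    (\<forall>x y. g (x + y) = g x + g y) \<and> (\<forall>a x. g (scale a x) = a * g x)"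

lemma laurent_linear_iff:
  assumes "Modules.module scale"
  shows "laurent_linear scale g \<longleftrightarrow> Modules.module_hom scale (*) g"
proof
  assume "laurent_linear scale g"
  moreover have "Modules.module ((*) :: laurent \<Rightarrow> laurent \<Rightarrow> laurent)"
    by unfold_locales (simp_all add: algebra_simps)
  ultimately show "Modules.module_hom scale (*) g"
    using assms unfolding laurent_linear_def module_hom_def module_hom_axioms_def by blast
next
  assume "Modules.module_hom scale (*) g"
  then show "laurent_linear scale g"
    unfolding laurent_linear_def module_hom_def module_hom_axioms_def by blast
qed

lemma qpow_add: "qpow a * qpow b = qpow (a + b)"
  by (simp add: qpow_def mult_single)

lemma qpow_0 [simp]: "qpow 0 = 1"
  by (simp add: qpow_def)

context hecke_algebra
begin

abbreviation linear where "linear \<equiv> laurent_linear scale"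

lemma linearD:
  assumes "linear g"
  shows "g (x + y) = g x + g y" "g (scale a x) = a * g x" "g 0 = 0" "g (x - y) = g x - g y"
proof -
  show add: "g (x + y) = g x + g y" and "g (scale a x) = a * g x" for x y a
    using assms by (auto simp: laurent_linear_def)
  from add[of 0 0] show "g 0 = 0" by simp
  from add[of "x - y" y] show "g (x - y) = g x - g y" by simp
qed

lemma linear_comp_mult:
  assumes "linear g"
  shows "linear (\<lambda>x. g (a * x))" "linear (\<lambda>x. g (x * b))"
  using assms
  by (auto simp: laurent_linear_def scale_mult_left scale_mult_right distrib_left distrib_right)

lemma linear_arith:
  assumes "linear g"
  shows "linear (\<lambda>x. a * g x)" "linear g' \<Longrightarrow> linear (\<lambda>x. g x + g' x)"
  using assms by (auto simp: laurent_linear_def algebra_simps)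

lemma linear_eq_on_span:
  assumes "linear g" "linear g'" "\<And>x. x \<in> A \<Longrightarrow> g x = g' x" "x \<in> H.span A"
  shows "g x = g' x"
  using assms(4) by (induction rule: H.span_induct_alt) (simp_all add: assms(1-3) linearD)

lemma linear_eqI:
  assumes "linear g" "linear g'" "\<And>w. w \<in> carrier W \<Longrightarrow> g (T w) = g' (T w)"
  shows "g x = g' x"
  using linear_eq_on_span[of g g' "T ` carrier W" x] assms T_spanning by auto

lemma T_one [simp]: "T \<one> = 1"
  using T_reduced[of "[]"] by simp

lemma T_mult:
  assumes "x \<in> carrier W" "y \<in> carrier W" "\<ell> (x \<otimes> y) = \<ell> x + \<ell> y"
  shows "T x * T y = T (x \<otimes> y)"
proof -
  obtain xs where xs: "reduced xs" "\<pi> xs = x" using ex_reduced assms by blast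
  obtain ys where ys: "reduced ys" "\<pi> ys = y" using ex_reduced assms by blast
  have l: "xs \<in> lists S" "ys \<in> lists S" "xs @ ys \<in> lists S"
    using xs ys by (auto simp: reduced_def)
  then have "\<pi> (xs @ ys) = x \<otimes> y" using word_append xs ys by simp
  moreover have "length (xs @ ys) = \<ell> (x \<otimes> y)" using assms xs ys by (simp add: reduced_def)
  ultimately have "T (x \<otimes> y) = prod_list (map T (xs @ ys))" using T_reduced[OF l(3)] by simp
  then show ?thesis using T_reduced[of xs] T_reduced[of ys] xs ys by (simp add: reduced_def)
qed

lemma T_S_up:
  assumes "s \<in> S" "w \<in> carrier W" "\<not> \<ell> (s \<otimes> w) < \<ell> w"
  shows "T s * T w = T (s \<otimes> w)"
  using left_less_cases[of w s] assms by (intro T_mult) auto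

lemma T_S_square: "s \<in> S \<Longrightarrow> T s * T s = scale (qpow 1) 1 + scale (qpow 1 - 1) (T s)"
  using quadratic[of s]
  by (simp add: algebra_simps scale_mult_left scale_mult_right H.scale_left_diff_distrib)

lemma T_S_down:
  assumes "s \<in> S" "w \<in> carrier W" "\<ell> (s \<otimes> w) < \<ell> w"
  shows "T s * T w = scale (qpow 1) (T (s \<otimes> w)) + scale (qpow 1 - 1) (T w)"
proof -
  have w: "T w = T s * T (s \<otimes> w)" using T_S_up[of s "s \<otimes> w"] assms by simp
  then have "T s * T w = (T s * T s) * T (s \<otimes> w)" by (simp add: mult.assoc)
  also have "\<dots> = scale (qpow 1) (T (s \<otimes> w)) + scale (qpow 1 - 1) (T s * T (s \<otimes> w))"
    using assms by (simp add: T_S_square distrib_right scale_mult_left)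
  finally show ?thesis using w by simp
qed

lemma T_S_span:
  assumes "s \<in> S" "w \<in> carrier W"
  shows "T s * T w \<in> H.span (T ` {w, s \<otimes> w})"
proof (cases "\<ell> (s \<otimes> w) < \<ell> w")
  case True
  show ?thesis unfolding T_S_down[OF assms True]
    by (intro H.span_add H.span_scale H.span_base) auto
next
  case False
  show ?thesis unfolding T_S_up[OF assms False] by (intro H.span_base) auto
qed

text \<open>Multiplying by \<open>T s\<close> on the left produces only the basis elements at w and
  s w. So every basis element that occurs is a translate of \<open>v\<close> by an element of W_K of
  bounded length; \<open>supp_T\<close> uses both facts.\<close>

lemma T_word_span:
  assumes "K \<subseteq> S" "v \<in> carrier W"
  shows "xs \<in> lists K \<Longrightarrow> reduced xs \<Longrightarrow>
    T (\<pi> xs) * T v \<in> H.span (T ` (\<lambda>x. x \<otimes> v) ` {x \<in> generate W K. \<ell> x \<le> length xs})"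
proof (induction xs)
  case Nil
  have "v = \<one> \<otimes> v" using assms by simp
  then have "T v \<in> T ` (\<lambda>x. x \<otimes> v) ` {x \<in> generate W K. \<ell> x \<le> length []}"
    by (intro imageI image_eqI[of v _ \<one>]) auto
  then show ?case by (simp add: H.span_base)
next
  case (Cons s xs)
  note d = reduced_ConsD[OF Cons.prems(2)]
  have s: "s \<in> K" "xs \<in> lists K" using Cons.prems by auto
  let ?A = "\<lambda>n. T ` (\<lambda>x. x \<otimes> v) ` {x \<in> generate W K. \<ell> x \<le> n}"
  have "T (\<pi> (s # xs)) = T s * T (\<pi> xs)" using T_S_up[OF d(2,3)] d(4) by simp
  moreover have "T s * y \<in> H.span (?A (Suc n))" if "y \<in> H.span (?A n)" for y n
    using that
  proof (induction rule: H.span_induct_alt)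
    case base
    show ?case by (simp add: H.span_zero)
  next
    case (step c x y)
    then obtain z where z: "z \<in> generate W K" "\<ell> z \<le> n" "x = T (z \<otimes> v)" by auto
    have zc: "z \<in> carrier W" using z assms by simp
    have "\<ell> (s \<otimes> z) \<le> Suc n" using len_mult_le[of s z] zc d(2) z by simp
    moreover have "s \<otimes> (z \<otimes> v) = (s \<otimes> z) \<otimes> v" using zc d(2) assms by (simp add: m_assoc)
    ultimately have "T ` {z \<otimes> v, s \<otimes> (z \<otimes> v)} \<subseteq> ?A (Suc n)"
      using z s by (auto intro!: imageI)
    then have "H.span (T ` {z \<otimes> v, s \<otimes> (z \<otimes> v)}) \<subseteq> H.span (?A (Suc n))"
      by (rule H.span_mono)
    moreover have "T s * x \<in> H.span (T ` {z \<otimes> v, s \<otimes> (z \<otimes> v)})"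
      unfolding z(3) using T_S_span[OF d(2), of "z \<otimes> v"] zc assms by simp
    ultimately have "T s * x \<in> H.span (?A (Suc n))" by blast
    then show ?case using step by (simp add: distrib_left scale_mult_right H.span_add H.span_scale)
  qed
  ultimately show ?case using Cons.IH[OF s(2) d(1)] by (simp add: mult.assoc)
qed

lemma T_mult_span:
  assumes "K \<subseteq> S" "v \<in> carrier W" "x \<in> generate W K"
  shows "T x * T v \<in> H.span (T ` (\<lambda>x. x \<otimes> v) ` {x' \<in> generate W K. \<ell> x' \<le> \<ell> x})"
proof -
  obtain xs where "reduced xs" "xs \<in> lists K" "\<pi> xs = x" using generate_ex_reduced assms by metis
  then show ?thesis using T_word_span[OF assms(1,2), of xs] by (simp add: reduced_def)
qed

abbreviation HP where "HP \<equiv> parabolic_hecke W scale T"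

lemma T_HP [simp]: "x \<in> generate W K \<Longrightarrow> T x \<in> HP K"
  by (simp add: parabolic_hecke_def H.span_base)

lemma HP_closed [simp]:
  "x \<in> HP K \<Longrightarrow> y \<in> HP K \<Longrightarrow> x + y \<in> HP K"
  "x \<in> HP K \<Longrightarrow> y \<in> HP K \<Longrightarrow> x - y \<in> HP K"
  "x \<in> HP K \<Longrightarrow> scale a x \<in> HP K"
  "0 \<in> HP K"
  by (simp_all add: parabolic_hecke_def H.span_add H.span_diff H.span_scale H.span_zero)

lemma HP_mult [simp]:
  assumes K: "K \<subseteq> S" and x: "x \<in> HP K" and y: "y \<in> HP K"
  shows "x * y \<in> HP K"
proof -
  have T: "T a * T b \<in> HP K" if "a \<in> generate W K" "b \<in> generate W K" for a b
  proof -
    have "T ` (\<lambda>x. x \<otimes> b) ` {x' \<in> generate W K. \<ell> x' \<le> \<ell> a} \<subseteq> T ` generate W K"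
      using that by auto
    then show ?thesis
      using T_mult_span[OF K _ that(1), of b] that K H.span_mono
      unfolding parabolic_hecke_def by (meson generate_closed subsetD)
  qed
  have Ty: "T a * y \<in> HP K" if "a \<in> generate W K" for a
    using y unfolding parabolic_hecke_def[of _ _ _ K]
  proof (induction rule: H.span_induct_alt)
    case (step c z y)
    then show ?case using T[OF that]
      by (auto simp: distrib_left scale_mult_right simp flip: parabolic_hecke_def)
  qed (simp add: H.span_zero)
  from x show ?thesis unfolding parabolic_hecke_def[of _ _ _ K]
  proof (induction rule: H.span_induct_alt)
    case (step c z x)
    then show ?case using Ty
      by (auto simp: distrib_right scale_mult_left simp flip: parabolic_hecke_def)
  qed (simp add: H.span_zero)
qed

text \<open>At \<open>q = 1\<close> the Hecke algebra is the group ring.\<close>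
lemma T_S_mod:
  assumes "s \<in> S" "w \<in> carrier W"
  shows "\<exists>h\<in>H.span {T w, T (s \<otimes> w)}. T s * T w = T (s \<otimes> w) + scale (qpow 1 - 1) h"
proof (cases "\<ell> (s \<otimes> w) < \<ell> w")
  case True
  then have "T s * T w = T (s \<otimes> w) + scale (qpow 1 - 1) (T (s \<otimes> w) + T w)"
    using T_S_down[OF assms]
    by (simp add: H.scale_left_diff_distrib H.scale_right_distrib algebra_simps)
  moreover have "T (s \<otimes> w) + T w \<in> H.span {T w, T (s \<otimes> w)}"
    by (intro H.span_add H.span_base) auto
  ultimately show ?thesis by blast
next
  case False
  then show ?thesis using T_S_up[OF assms] H.span_zero by (intro bexI[of _ 0]) auto
qed

text \<open>The error term remains in the parabolic subalgebra, so a form defined there can be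
  applied to it in \<open>f_conj_mod\<close>.\<close>

lemma T_mult_mod:
  assumes K: "K \<subseteq> S" and x: "x \<in> generate W K" and y: "y \<in> generate W K"
  shows "\<exists>h\<in>HP K. T x * T y = T (x \<otimes> y) + scale (qpow 1 - 1) h"
proof -
  have yc: "y \<in> carrier W" using y K by simp
  have "\<exists>h\<in>HP K. T (\<pi> xs) * T y = T (\<pi> xs \<otimes> y) + scale (qpow 1 - 1) h"
    if "reduced xs" "xs \<in> lists K" for xs
    using that
  proof (induction xs)
    case Nil
    show ?case using yc by (intro bexI[of _ 0]) auto
  next
    case (Cons s xs)
    note d = reduced_ConsD[OF Cons.prems(1)]
    have s: "s \<in> K" "xs \<in> lists K" using Cons.prems by auto
    obtain h where h: "h \<in> HP K" "T (\<pi> xs) * T y = T (\<pi> xs \<otimes> y) + scale (qpow 1 - 1) h"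
      using Cons.IH[OF d(1) s(2)] by blast
    have xK: "\<pi> xs \<otimes> y \<in> generate W K" using word_generate K s y by simp
    then have xc: "\<pi> xs \<otimes> y \<in> carrier W" using K by simp
    obtain h' where h': "h' \<in> H.span {T (\<pi> xs \<otimes> y), T (s \<otimes> (\<pi> xs \<otimes> y))}"
      "T s * T (\<pi> xs \<otimes> y) = T (s \<otimes> (\<pi> xs \<otimes> y)) + scale (qpow 1 - 1) h'"
      using T_S_mod[OF d(2) xc] by blast
    have "{T (\<pi> xs \<otimes> y), T (s \<otimes> (\<pi> xs \<otimes> y))} \<subseteq> T ` generate W K"
      using xK s by auto
    then have h'K: "h' \<in> HP K" using h'(1) H.span_mono unfolding parabolic_hecke_def by blast
    have "T (\<pi> (s # xs)) * T y = T s * (T (\<pi> xs) * T y)"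
      using T_S_up[OF d(2,3)] d(4) by (simp flip: mult.assoc)
    also have "\<dots> = T (\<pi> (s # xs) \<otimes> y) + scale (qpow 1 - 1) (h' + T s * h)"
      using h(2) h'(2) d yc
      by (simp add: m_assoc distrib_left scale_mult_right H.scale_right_distrib add.assoc)
    finally show ?case using h'K h(1) K s by (intro bexI[of _ "h' + T s * h"]) auto
  qed
  then show ?thesis using generate_ex_reduced[OF K x] by metis
qed

end

section \<open>The canonical trace and coordinates in the standard basis\<close>

locale hecke_trace = hecke_algebra W S scale T
  for W (structure) and S :: "'a set" and scale :: "laurent \<Rightarrow> 'h::ring_1 \<Rightarrow> 'h" and T +
  fixes \<tau> :: "'h \<Rightarrow> laurent"
  assumes is_tau: "is_tau W scale T \<tau>"
begin

lemma tau_linear: "linear \<tau>"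
  using is_tau laurent_linear_iff[OF scale_module] by (simp add: is_tau_def)

lemma tau_T: "w \<in> carrier W \<Longrightarrow> \<tau> (T w) = (if w = \<one> then 1 else 0)"
  using is_tau by (auto simp: is_tau_def)

text \<open>Up to powers of q, the bases \<open>T x\<close> and \<open>T (inv x)\<close> are dual
  for the form given by \<open>\<tau>\<close>. The proof moves the letters of the first factor one
  at a time onto the second.\<close>

lemma tau_T_mult:
  assumes "x \<in> carrier W" "y \<in> carrier W"
  shows "\<tau> (T x * T y) = (if y = inv x then qpow (int (\<ell> x)) else 0)"
proof -
  have "\<tau> (T (inv (\<pi> xs)) * T y) = (if y = \<pi> xs then qpow (int (length xs)) else 0)"
    if "reduced xs" "y \<in> carrier W" for xs y
    using that
  proof (induction xs arbitrary: y)
    case Nil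
    then show ?case by (simp add: tau_T)
  next
    case (Cons s xs)
    note d = reduced_ConsD[OF Cons.prems(1)] and y = Cons.prems(2)
    let ?x = "inv (\<pi> xs)"
    have "\<ell> (?x \<otimes> s) = \<ell> ?x + \<ell> s"
      using d len_inv[of "s \<otimes> \<pi> xs"] by (simp add: inv_mult_group)
    then have Tx: "T (inv (\<pi> (s # xs))) = T ?x * T s"
      using T_mult[of ?x s] d by (simp add: inv_mult_group)
    have len: "length (s # xs) = Suc (length xs)" "\<ell> (\<pi> xs) = length xs"
      using d(1) by (auto simp: reduced_def)
    have sy: "s \<otimes> y = \<pi> xs \<longleftrightarrow> y = \<pi> (s # xs)"
      using d(2,3) y by (metis S_cancel word_Cons)
    show ?case
    proof (cases "\<ell> (s \<otimes> y) < \<ell> y")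
      case True
      \<comment> \<open>The summand with factor q - 1 would contribute only at
        \<open>y = \<pi> xs\<close>, but \<open>s\<close> lengthens that element.\<close>
      have "y \<noteq> \<pi> xs" using True d(4) by auto
      moreover have "qpow 1 * qpow (int (length xs)) = qpow (int (length (s # xs)))"
        by (simp add: qpow_add)
      moreover have "T ?x * (T s * T y) =
          scale (qpow 1) (T ?x * T (s \<otimes> y)) + scale (qpow 1 - 1) (T ?x * T y)"
        by (simp add: T_S_down[OF d(2) y True] distrib_left scale_mult_right)
      ultimately show ?thesis
        using Cons.IH[OF d(1), of "s \<otimes> y"] Cons.IH[OF d(1) y] sy d(2) y
        by (simp add: Tx mult.assoc linearD[OF tau_linear] del: word_Cons)
    next
      case False
      have "y \<noteq> \<pi> (s # xs)" using False d(2,3,4) by auto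
      then show ?thesis
        using Cons.IH[OF d(1), of "s \<otimes> y"] T_S_up[OF d(2) y False] sy d(2) y
        by (simp add: Tx mult.assoc del: word_Cons)
    qed
  qed
  moreover obtain xs where "reduced xs" "\<pi> xs = inv x" using ex_reduced[of "inv x"] assms by auto
  ultimately show ?thesis using assms by (metis inv_inv len_inv reduced_def)
qed

text \<open>The coefficient of \<open>T w\<close> in the standard basis, extracted by the duality of
  \<open>tau_T_mult\<close>.\<close>

definition coef :: "'a \<Rightarrow> 'h \<Rightarrow> laurent" where
  "coef w h = qpow (- int (\<ell> w)) * \<tau> (T (inv w) * h)"

lemma coef_linear: "linear (coef w)"
  unfolding coef_def by (intro linear_arith linear_comp_mult tau_linear)

lemma coef_T:
  assumes "w \<in> carrier W" "y \<in> carrier W"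
  shows "coef w (T y) = (if y = w then 1 else 0)"
  using tau_T_mult[of "inv w" y] assms by (simp add: coef_def qpow_add)

lemma coef_span:
  assumes "h \<in> H.span (T ` A)" "A \<subseteq> carrier W" "w \<in> carrier W" "coef w h \<noteq> 0"
  shows "w \<in> A"
proof (rule ccontr)
  assume w: "w \<notin> A"
  have "coef w h = (\<lambda>_. 0) h"
    by (rule linear_eq_on_span[OF coef_linear _ _ assms(1)])
      (use w assms coef_T in \<open>auto simp: laurent_linear_def\<close>)
  with assms show False by simp
qed

lemma finite_coef: "finite {w \<in> carrier W. coef w h \<noteq> 0}"
proof -
  have "h \<in> H.span (T ` carrier W)" using T_spanning by simp
  then show ?thesis
  proof (induction rule: H.span_induct_alt)
    case base
    show ?case by (simp add: linearD(3)[OF coef_linear])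
  next
    case (step c x y)
    then obtain z where z: "z \<in> carrier W" "x = T z" by blast
    have "{w \<in> carrier W. coef w (scale c x + y) \<noteq> 0} \<subseteq> insert z {w \<in> carrier W. coef w y \<noteq> 0}"
      using z by (auto simp: linearD[OF coef_linear] coef_T split: if_splits)
    then show ?case using step finite_subset by blast
  qed
qed

definition lift :: "('a \<Rightarrow> laurent) \<Rightarrow> 'h \<Rightarrow> laurent" where
  "lift \<phi> h = (\<Sum>w | w \<in> carrier W \<and> coef w h \<noteq> 0. coef w h * \<phi> w)"

lemma lift_superset:
  assumes "finite B" "B \<subseteq> carrier W"
    and "\<And>w. w \<in> carrier W \<Longrightarrow> coef w h \<noteq> 0 \<Longrightarrow> \<phi> w \<noteq> 0 \<Longrightarrow> w \<in> B"
  shows "lift \<phi> h = (\<Sum>w\<in>B. coef w h * \<phi> w)"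
proof -
  have "(\<Sum>w\<in>B. coef w h * \<phi> w) = (\<Sum>w\<in>B \<inter> {w \<in> carrier W. coef w h \<noteq> 0}. coef w h * \<phi> w)"
    using assms by (intro sum.mono_neutral_right) auto
  also have "\<dots> = lift \<phi> h"
    unfolding lift_def using assms finite_coef[of h] by (intro sum.mono_neutral_left) auto
  finally show ?thesis by simp
qed

lemma lift_linear: "linear (lift \<phi>)"
  unfolding laurent_linear_def
proof (intro conjI allI)
  fix x y a
  let ?B = "{w \<in> carrier W. coef w x \<noteq> 0} \<union> {w \<in> carrier W. coef w y \<noteq> 0}"
  have B: "finite ?B" "?B \<subseteq> carrier W" using finite_coef by auto
  note c = linearD[OF coef_linear]
  have "lift \<phi> (x + y) = (\<Sum>w\<in>?B. coef w (x + y) * \<phi> w)"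
    by (intro lift_superset B) (auto simp: c)
  moreover have "lift \<phi> x = (\<Sum>w\<in>?B. coef w x * \<phi> w)" "lift \<phi> y = (\<Sum>w\<in>?B. coef w y * \<phi> w)"
    by (intro lift_superset B; auto)+
  ultimately show "lift \<phi> (x + y) = lift \<phi> x + lift \<phi> y"
    by (simp add: c distrib_right sum.distrib)
  have "lift \<phi> (scale a x) = (\<Sum>w\<in>?B. coef w (scale a x) * \<phi> w)"
    by (intro lift_superset B) (auto simp: c)
  moreover have "lift \<phi> x = (\<Sum>w\<in>?B. coef w x * \<phi> w)"
    by (intro lift_superset B; auto)
  ultimately show "lift \<phi> (scale a x) = a * lift \<phi> x"
    by (simp add: c mult.assoc sum_distrib_left)
qed

lemma lift_T: "w \<in> carrier W \<Longrightarrow> lift \<phi> (T w) = \<phi> w"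
  using lift_superset[of "{w}" "T w" \<phi>] by (simp add: coef_T split: if_splits)

end

section \<open>The induced form\<close>

locale hecke_induction = hecke_trace W S scale T \<tau>
  for W (structure) and S :: "'a set" and scale :: "laurent \<Rightarrow> 'h::ring_1 \<Rightarrow> 'h" and T \<tau> +
  fixes I J :: "'a set" and f :: "'h \<Rightarrow> laurent"
  assumes I: "I \<subseteq> S" and J: "J \<subseteq> I"
    and normalizer: "normalizer W (generate W J) \<subseteq> generate W I"
    and form: "cocenter_form scale (parabolic_hecke W scale T I) f"
    and vanishing: "\<lbrakk>J' \<subseteq> I; \<not> (\<exists>K\<subseteq>J'. conj_under W (generate W I) J K); w \<in> generate W J'\<rbrakk> \<Longrightarrow>
      f (T w) = 0"
begin

abbreviation WI where "WI \<equiv> generate W I"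

abbreviation supp where "supp h \<equiv> ind_support W S T \<tau> I f h"

abbreviation Ind where "Ind \<equiv> ind W S T \<tau> I f"

lemma WI_carrier [simp]: "x \<in> WI \<Longrightarrow> x \<in> carrier W"
  using I by simp

lemma f_support: "support_above I J (\<lambda>y. f (T y) \<noteq> 0)"
  using vanishing unfolding support_above_def by blast

lemma f_add: "\<lbrakk>x \<in> HP I; y \<in> HP I\<rbrakk> \<Longrightarrow> f (x + y) = f x + f y"
  and f_scale: "x \<in> HP I \<Longrightarrow> f (scale a x) = a * f x"
  using form by (auto simp: cocenter_form_def)

lemma f_trace:
  assumes "x \<in> HP I" "y \<in> HP I"
  shows "f (x * y) = f (y * x)"
proof -
  have "x * y - y * x \<in> commutator_span scale (HP I)"
    unfolding commutator_span_def using assms by (intro H.span_base) blast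
  then have "f (x * y - y * x) = 0" using form by (auto simp: cocenter_form_def)
  then show ?thesis using f_add[of "x * y - y * x" "y * x"] assms I by simp
qed

text \<open>Nothing is known about \<open>f\<close> outside the parabolic subalgebra, so the span
  induction has to carry membership in \<open>HP I\<close> along with the equality.\<close>

lemma f_eq_linear:
  assumes "linear g" "\<And>x. x \<in> WI \<Longrightarrow> g (T x) = f (T x)" "z \<in> HP I"
  shows "g z = f z"
proof -
  have "z \<in> HP I \<and> g z = f z"
    using assms(3) unfolding parabolic_hecke_def[of W scale T I]
  proof (induction rule: H.span_induct_alt)
    case base
    show ?case using f_scale[of 0 0] H.span_zero by (simp add: linearD[OF assms(1)])
  next
    case (step c x y)
    then obtain w where w: "w \<in> WI" "x = T w" by blast
    have y: "y \<in> HP I" "g y = f y" using step by (auto simp: parabolic_hecke_def)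
    have "scale c x + y \<in> HP I" using w y by simp
    moreover have "g (scale c x + y) = f (scale c x + y)"
      using w y by (simp add: linearD[OF assms(1)] assms(2) f_add f_scale)
    ultimately show ?case by (simp add: parabolic_hecke_def)
  qed
  then show ?thesis by simp
qed

section \<open>Coordinates of the Hecke algebra over the parabolic subalgebra\<close>

text \<open>\<open>H\<close> is a free right \<open>H\<^sub>I\<close>-module with basis \<open>T\<^sub>v\<close>, \<open>v \<in> W\<^sup>I\<close>; \<open>F v\<close> is \<open>f\<close> applied to the
  coordinate at \<open>T\<^sub>v\<close>, so that the induced form is the sum of the \<open>F v (h T\<^sub>v)\<close>.\<close>
definition F :: "'a \<Rightarrow> 'h \<Rightarrow> laurent" where
  "F v = lift (\<lambda>w. if inv v \<otimes> w \<in> WI then f (T (inv v \<otimes> w)) else 0)"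

lemma F_linear: "linear (F v)"
  unfolding F_def by (rule lift_linear)

lemma T_reps_mult:
  assumes "u \<in> reps I" "x \<in> WI"
  shows "T u * T x = T (u \<otimes> x)"
  using T_mult[of u x] reps_len_mult[OF I] assms repsD(1) by simp

lemma F_T_mult:
  assumes v: "v \<in> reps I" and u: "u \<in> reps I" and x: "x \<in> WI"
  shows "F v (T u * T x) = (if u = v then f (T x) else 0)"
proof -
  have c: "v \<in> carrier W" "u \<in> carrier W" "x \<in> carrier W" using u v x repsD(1) by auto
  have "u = v" if "inv v \<otimes> (u \<otimes> x) \<in> WI"
    using reps_unique(1)[OF I u v x that] c by simp
  then show ?thesis
    using c x by (auto simp: T_reps_mult[OF u x] F_def lift_T)
qed

lemma F_mult:
  assumes v: "v \<in> reps I" and u: "u \<in> reps I" and z: "z \<in> HP I"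
  shows "F v (T u * z) = (if u = v then f z else 0)"
proof (cases "u = v")
  case True
  then show ?thesis
    using f_eq_linear[OF linear_comp_mult(1)[OF F_linear, of v "T v"] _ z] F_T_mult[OF v u] by simp
next
  case False
  have "F v (T u * z) = (\<lambda>_. 0) z"
    by (rule linear_eq_on_span[OF linear_comp_mult(1)[OF F_linear], of _ "T ` WI"])
      (use F_T_mult[OF v u] False z in \<open>auto simp: laurent_linear_def parabolic_hecke_def\<close>)
  then show ?thesis using False by simp
qed

lemma linear_eqI_reps:
  assumes "linear g" "linear g'"
    and "\<And>u x. \<lbrakk>u \<in> reps I; x \<in> WI\<rbrakk> \<Longrightarrow> g (T u * T x) = g' (T u * T x)"
  shows "g y = g' y"
proof (rule linear_eqI[OF assms(1,2)])
  fix w assume "w \<in> carrier W"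
  then obtain u x where "u \<in> reps I" "x \<in> WI" "w = u \<otimes> x" by (rule ex_reps[OF I])
  then show "g (T w) = g' (T w)" using assms(3)[of u x] T_reps_mult by simp
qed

lemma swap_not_reps:
  assumes "u \<in> reps I" "t \<in> I"
  shows "u \<otimes> t \<notin> reps I"
  using reps_unique(1)[OF I, of "u \<otimes> t" u \<one> t] assms repsD(1) I not_one[of t] by force

lemma T_S_rep_swap:
  assumes "s \<in> S" "u \<in> reps I" "t \<in> I" "s \<otimes> u = u \<otimes> t"
  shows "T s * T u = T u * T t"
proof -
  have "\<not> \<ell> (s \<otimes> u) < \<ell> u" using repsD(2)[OF assms(2,3)] assms(4) by simp
  then show ?thesis
    using T_S_up[of s u] assms repsD(1) T_reps_mult[of u t] by simp
qed

text \<open>Here \<open>T s * T v = T v * T t\<close>, so \<open>T s\<close> multiplies the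
  coordinate at \<open>T v\<close> by \<open>T t\<close> from the left. The trace property of
  \<open>f\<close> moves this factor to the right, where it becomes right multiplication of
  \<open>y\<close>.\<close>

lemma F_T_S_swap:
  assumes s: "s \<in> S" and t: "t \<in> I" and v: "v \<in> reps I" and sv: "s \<otimes> v = v \<otimes> t"
  shows "F v (T s * y) = F v (y * T t)"
proof (rule linear_eqI_reps[OF linear_comp_mult[OF F_linear]])
  fix u x assume u: "u \<in> reps I" and x: "x \<in> WI"
  have c: "u \<in> carrier W" "v \<in> carrier W" using u v repsD(1) by auto
  have tx: "T x \<in> HP I" "T t \<in> HP I" using t x by simp_all
  have "F v (T u * T x * T t) = (if u = v then f (T x * T t) else 0)"
    using F_mult[OF v u, of "T x * T t"] tx I by (simp add: mult.assoc)
  moreover have "F v (T s * (T u * T x)) = (if u = v then f (T x * T t) else 0)"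
    using I u s
  proof (cases rule: deodhar)
    case rep
    have "u \<noteq> v" using rep sv swap_not_reps[OF v t] by auto
    moreover have "s \<otimes> u \<noteq> v"
    proof
      assume "s \<otimes> u = v"
      then have "u = v \<otimes> t" using sv s c by (metis S_cancel)
      then show False using u swap_not_reps[OF v t] by simp
    qed
    ultimately have "F v (T (s \<otimes> u) * T x) = 0" "F v (T u * T x) = 0"
      using F_T_mult[OF v] rep u x by simp_all
    then show ?thesis
      using \<open>u \<noteq> v\<close> T_S_up[OF s c(1)] T_S_down[OF s c(1)]
      by (cases "\<ell> (s \<otimes> u) < \<ell> u")
        (simp_all add: distrib_right scale_mult_left linearD[OF F_linear] flip: mult.assoc)
  next
    case (swap t')
    have "F v (T s * (T u * T x)) = F v (T u * (T t' * T x))"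
      using T_S_rep_swap[OF s u swap] by (simp flip: mult.assoc)
    also have "\<dots> = (if u = v then f (T t' * T x) else 0)"
      using F_mult[OF v u, of "T t' * T x"] swap tx I by simp
    also have "\<dots> = (if u = v then f (T x * T t) else 0)"
    proof (cases "u = v")
      case True
      then have "v \<otimes> t' = v \<otimes> t" using swap sv by simp
      moreover have "t \<in> carrier W" "t' \<in> carrier W" using t swap(1) I by auto
      ultimately have "t' = t" using c by simp
      then show ?thesis using f_trace[OF tx] by simp
    qed simp
    finally show ?thesis .
  qed
  ultimately show "F v (T s * (T u * T x)) = F v (T u * T x * T t)" by simp
qed

text \<open>\<open>T v\<close> and \<open>T (s \<otimes> v)\<close> span a block over H_I that is
  stable under \<open>T s\<close>. The two formulas are the rows of the matrix of \<open>T s\<close>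
  on this block.\<close>

lemma F_T_S_pair:
  assumes s: "s \<in> S" and v: "v \<in> reps I" "s \<otimes> v \<in> reps I" and up: "\<ell> v < \<ell> (s \<otimes> v)"
  shows "F v (T s * y) = qpow 1 * F (s \<otimes> v) y"
    and "F (s \<otimes> v) (T s * y) = F v y + (qpow 1 - 1) * F (s \<otimes> v) y"
proof -
  let ?v = "s \<otimes> v"
  have vc: "v \<in> carrier W" using v repsD(1) by auto
  have *: "F v (T s * (T u * T x)) = qpow 1 * F ?v (T u * T x) \<and>
    F ?v (T s * (T u * T x)) = F v (T u * T x) + (qpow 1 - 1) * F ?v (T u * T x)"
    if u: "u \<in> reps I" and x: "x \<in> WI" for u x
    using I u s
  proof (cases rule: deodhar)
    case rep
    have c: "u \<in> carrier W" using u repsD(1) by auto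
    have eq: "s \<otimes> u = v \<longleftrightarrow> u = ?v" "s \<otimes> u = ?v \<longleftrightarrow> u = v"
      using S_cancel[OF s c] S_cancel[OF s vc] s c vc by auto
    note FT = F_T_mult[OF v(1) u x] F_T_mult[OF v(2) u x]
      F_T_mult[OF v(1) rep x] F_T_mult[OF v(2) rep x]
    show ?thesis
    proof (cases "\<ell> (s \<otimes> u) < \<ell> u")
      case True
      then have "u \<noteq> v" using up by auto
      moreover have "T s * (T u * T x) =
          scale (qpow 1) (T (s \<otimes> u) * T x) + scale (qpow 1 - 1) (T u * T x)"
        by (simp add: T_S_down[OF s c True] distrib_right scale_mult_left flip: mult.assoc)
      ultimately show ?thesis by (simp add: linearD[OF F_linear] FT eq)
    next
      case False
      then have "u \<noteq> ?v" using up s vc by auto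
      moreover have "T s * (T u * T x) = T (s \<otimes> u) * T x"
        by (simp add: T_S_up[OF s c False] flip: mult.assoc)
      ultimately show ?thesis by (simp add: FT eq)
    qed
  next
    case (swap t)
    have c: "u \<in> carrier W" using u repsD(1) by auto
    have "T s * (T u * T x) = T u * (T t * T x)"
      using T_S_rep_swap[OF s u swap] by (simp flip: mult.assoc)
    moreover have "u \<noteq> v" "u \<noteq> ?v"
      using v swap swap_not_reps[OF u swap(1)] s vc by auto
    moreover have "T t * T x \<in> HP I" using swap x I by simp
    ultimately show ?thesis using F_mult[OF _ u] F_T_mult[OF _ u x] v by simp
  qed
  show "F v (T s * y) = qpow 1 * F ?v y"
    by (rule linear_eqI_reps[OF linear_comp_mult(1)[OF F_linear] linear_arith(1)[OF F_linear]])
      (use * in blast)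
  show "F ?v (T s * y) = F v y + (qpow 1 - 1) * F ?v y"
    by (rule linear_eqI_reps[OF linear_comp_mult(1)[OF F_linear]
          linear_arith(2)[OF F_linear linear_arith(1)[OF F_linear]]])
      (use * in blast)
qed

section \<open>The support of the defining sum\<close>

lemma ind_term_eq:
  assumes "v \<in> reps I" "y \<in> WI"
  shows "ind_term W S T \<tau> f h v y = f (T y) * coef (v \<otimes> y) (h * T v)"
proof -
  \<comment> \<open>Lengths add, so the power of q and the value of \<open>\<tau>\<close> combine
    into the coefficient of \<open>T (v \<otimes> y)\<close> in \<open>h * T v\<close>.\<close>
  have "- int (\<ell> (v \<otimes> y)) = - int (\<ell> v) - int (\<ell> y)" using reps_len_mult[OF I assms] by simp
  then show ?thesis unfolding ind_term_def coef_def by (simp add: mult.assoc)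
qed

lemma supp_iff:
  "(v, y) \<in> supp h \<longleftrightarrow>
    v \<in> reps I \<and> y \<in> WI \<and> f (T y) * coef (v \<otimes> y) (h * T v) \<noteq> 0"
  using ind_term_eq by (auto simp: ind_support_def)

text \<open>\<open>T w * T v\<close> involves only elements x v with x in W_K no longer than
  \<open>w\<close>. A non-zero coefficient at v y therefore identifies x with v y v^-1.\<close>

lemma supp_T:
  assumes K: "K \<subseteq> S" and w: "w \<in> generate W K" and vy: "(v, y) \<in> supp (T w)"
  shows "v \<in> reps I" "y \<in> WI" "f (T y) \<noteq> 0" "cj v y \<in> generate W K" "\<ell> (cj v y) \<le> \<ell> w"
proof -
  show v: "v \<in> reps I" and y: "y \<in> WI" and "f (T y) \<noteq> 0" using vy by (auto simp: supp_iff)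
  have c: "v \<in> carrier W" "y \<in> carrier W" using v y repsD(1) by auto
  let ?A = "(\<lambda>x. x \<otimes> v) ` {x \<in> generate W K. \<ell> x \<le> \<ell> w}"
  have "v \<otimes> y \<in> ?A"
    using vy c K by (intro coef_span[OF T_mult_span[OF K c(1) w]]) (auto simp: supp_iff)
  then obtain x where x: "x \<in> generate W K" "\<ell> x \<le> \<ell> w" "v \<otimes> y = x \<otimes> v" by blast
  then have "cj v y = x" using c K by (simp add: m_assoc)
  then show "cj v y \<in> generate W K" "\<ell> (cj v y) \<le> \<ell> w" using x by simp_all
qed

lemma finite_coef_WI:
  assumes "v \<in> carrier W"
  shows "finite {y \<in> WI. coef (v \<otimes> y) h \<noteq> 0}"
proof (rule inj_on_finite)
  show "inj_on (\<lambda>y. v \<otimes> y) {y \<in> WI. coef (v \<otimes> y) h \<noteq> 0}"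
    using assms by (intro inj_onI) auto
  show "(\<lambda>y. v \<otimes> y) ` {y \<in> WI. coef (v \<otimes> y) h \<noteq> 0} \<subseteq> {w \<in> carrier W. coef w h \<noteq> 0}"
    using assms by auto
qed (rule finite_coef)

text \<open>For \<open>T w\<close>, \<open>supp_T\<close> bounds the length of v y v^-1 by that of
  \<open>w\<close>, which leaves finitely many \<open>v\<close>. For each of them, \<open>y\<close>
  is limited by the finite expansion of \<open>T w * T v\<close>.\<close>

lemma finite_supp: "finite (supp h)"
proof -
  have T: "finite (supp (T w))" if w: "w \<in> carrier W" for w
  proof (rule finite_subset)
    let ?V = "{v \<in> reps I. \<exists>y\<in>WI. f (T y) \<noteq> 0 \<and> \<ell> (cj v y) \<le> \<ell> w}"
    show "supp (T w) \<subseteq> Sigma ?V (\<lambda>v. {y \<in> WI. coef (v \<otimes> y) (T w * T v) \<noteq> 0})"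
    proof (rule subrelI)
      fix v y assume vy: "(v, y) \<in> supp (T w)"
      then have "v \<in> ?V"
        using supp_T[OF subset_refl _ vy] w generated by auto
      with vy show "(v, y) \<in> Sigma ?V (\<lambda>v. {y \<in> WI. coef (v \<otimes> y) (T w * T v) \<noteq> 0})"
        by (auto simp: supp_iff)
    qed
    have "finite ?V" by (rule finite_reps_supported[OF I J normalizer f_support])
    then show "finite (Sigma ?V (\<lambda>v. {y \<in> WI. coef (v \<otimes> y) (T w * T v) \<noteq> 0}))"
      using finite_coef_WI repsD(1) by (intro finite_SigmaI) auto
  qed
  have "h \<in> H.span (T ` carrier W)" using T_spanning by simp
  then show ?thesis
  proof (induction rule: H.span_induct_alt)
    case base
    show ?case
      by (rule finite_subset[of _ "{}"]) (auto simp: supp_iff linearD[OF coef_linear])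
  next
    case (step c x y)
    have "supp (scale c x + y) \<subseteq> supp x \<union> supp y"
      by (auto simp: supp_iff linearD[OF coef_linear] distrib_right scale_mult_left)
    moreover have "finite (supp x)" using T step by blast
    ultimately show ?case using step finite_subset by blast
  qed
qed

lemma F_eq_sum:
  assumes v: "v \<in> reps I"
  shows "F v h = (\<Sum>y | y \<in> WI \<and> coef (v \<otimes> y) h \<noteq> 0. f (T y) * coef (v \<otimes> y) h)"
proof -
  have c: "v \<in> carrier W" using v repsD(1) by auto
  let ?Y = "{y. y \<in> WI \<and> coef (v \<otimes> y) h \<noteq> 0}" and ?\<phi> = "\<lambda>w. if inv v \<otimes> w \<in> WI then f (T (inv v \<otimes> w)) else 0"
  have inj: "inj_on (\<lambda>y. v \<otimes> y) ?Y" using c by (intro inj_onI) auto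
  have "F v h = (\<Sum>w\<in>(\<lambda>y. v \<otimes> y) ` ?Y. coef w h * ?\<phi> w)"
    unfolding F_def
  proof (rule lift_superset)
    fix w assume w: "w \<in> carrier W" "coef w h \<noteq> 0" "?\<phi> w \<noteq> 0"
    then have "inv v \<otimes> w \<in> WI" by (auto split: if_splits)
    then show "w \<in> (\<lambda>y. v \<otimes> y) ` ?Y" using w c by (intro image_eqI[of _ _ "inv v \<otimes> w"]) auto
  qed (use c finite_coef_WI in auto)
  also have "\<dots> = (\<Sum>y\<in>?Y. coef (v \<otimes> y) h * ?\<phi> (v \<otimes> y))" by (simp add: sum.reindex[OF inj])
  also have "\<dots> = (\<Sum>y\<in>?Y. f (T y) * coef (v \<otimes> y) h)"
    using c by (intro sum.cong) (auto simp: mult.commute)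
  finally show ?thesis .
qed

text \<open>Representatives outside the support contribute 0. The freedom in \<open>V\<close> allows
  the induced form to be compared at several elements over one common index set.\<close>

lemma Ind_eq_sum:
  assumes V: "finite V" "V \<subseteq> reps I" "fst ` supp h \<subseteq> V"
  shows "Ind h = (\<Sum>v\<in>V. F v (h * T v))"
proof -
  let ?Y = "\<lambda>v. {y. y \<in> WI \<and> coef (v \<otimes> y) (h * T v) \<noteq> 0}"
  have fin: "finite (?Y v)" if "v \<in> V" for v using finite_coef_WI that V(2) repsD(1) by auto
  have "Ind h = (\<Sum>(v, y)\<in>supp h. f (T y) * coef (v \<otimes> y) (h * T v))"
    unfolding ind_def by (intro sum.cong) (auto simp: supp_iff ind_term_eq)
  also have "\<dots> = (\<Sum>(v, y)\<in>Sigma V ?Y. f (T y) * coef (v \<otimes> y) (h * T v))"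
  proof (rule sum.mono_neutral_left)
    show "finite (Sigma V ?Y)" using V fin by blast
    show "supp h \<subseteq> Sigma V ?Y"
    proof (rule subrelI)
      fix v y assume vy: "(v, y) \<in> supp h"
      then have "v \<in> V" using V(3) by force
      with vy show "(v, y) \<in> Sigma V ?Y" by (auto simp: supp_iff)
    qed
    show "\<forall>p\<in>Sigma V ?Y - supp h. (case p of (v, y) \<Rightarrow> f (T y) * coef (v \<otimes> y) (h * T v)) = 0"
      using V(2) by (auto simp: supp_iff)
  qed
  also have "\<dots> = (\<Sum>v\<in>V. \<Sum>y\<in>?Y v. f (T y) * coef (v \<otimes> y) (h * T v))"
    using V fin by (intro sum.Sigma[symmetric]) auto
  also have "\<dots> = (\<Sum>v\<in>V. F v (h * T v))"
    using V(2) by (intro sum.cong) (auto simp: F_eq_sum)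
  finally show ?thesis .
qed

lemma fst_supp: "finite (fst ` supp h)" "fst ` supp h \<subseteq> reps I"
  using finite_supp by (auto simp: supp_iff)

lemma Ind_linear: "linear Ind"
  unfolding laurent_linear_def
proof (intro conjI allI)
  fix x y a
  let ?V = "fst ` supp x \<union> fst ` supp y \<union> fst ` supp (x + y)"
  have V: "finite ?V" "?V \<subseteq> reps I" using fst_supp by auto
  note eq = Ind_eq_sum[OF V]
  show "Ind (x + y) = Ind x + Ind y"
    by (subst (1 2 3) eq) (auto simp: distrib_right linearD[OF F_linear] sum.distrib)
  let ?U = "fst ` supp x \<union> fst ` supp (scale a x)"
  have U: "finite ?U" "?U \<subseteq> reps I" using fst_supp by auto
  note eq = Ind_eq_sum[OF U]
  show "Ind (scale a x) = a * Ind x"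
    by (subst (1 2) eq) (auto simp: scale_mult_left linearD[OF F_linear] sum_distrib_left)
qed

section \<open>The trace property of the induced form\<close>

text \<open>Terms with \<open>s v = v t\<close> agree because \<open>f\<close> is a trace; the others cancel in pairs \<open>v\<close>, \<open>s v\<close>.\<close>
lemma Ind_T_S_commute:
  assumes s: "s \<in> S"
  shows "Ind (T s * h) = Ind (h * T s)"
proof -
  define A where "A = fst ` supp (T s * h) \<union> fst ` supp (h * T s)"
  have A: "finite A" "A \<subseteq> reps I" using fst_supp by (auto simp: A_def)
  \<comment> \<open>\<open>B\<close> adds the partners under \<open>s\<close> that are still in W^I,
    so that no pair in \<open>B1\<close> below is broken.\<close>
  define B where "B = {v \<in> reps I. v \<in> A \<or> s \<otimes> v \<in> A}"
  have B_reps: "B \<subseteq> reps I" by (auto simp: B_def)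
  have cB: "v \<in> carrier W" if "v \<in> B" for v using that repsD(1) by (auto simp: B_def)
  have "B \<subseteq> A \<union> (\<lambda>v. s \<otimes> v) ` A"
  proof
    fix v assume v: "v \<in> B"
    then have "v = s \<otimes> (s \<otimes> v)" using s cB by simp
    with v show "v \<in> A \<union> (\<lambda>v. s \<otimes> v) ` A" unfolding B_def by blast
  qed
  then have fin: "finite B" using A finite_subset by blast
  have AB: "A \<subseteq> B" using A by (auto simp: B_def)
  define D where "D v = F v (T s * h * T v) - F v (h * T s * T v)" for v
  have "Ind (T s * h) - Ind (h * T s) = (\<Sum>v\<in>B. D v)"
    using Ind_eq_sum[OF fin B_reps, of "T s * h"] Ind_eq_sum[OF fin B_reps, of "h * T s"] AB
    by (simp add: A_def D_def sum_subtractf)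
  also have "\<dots> = 0"
  proof -
    define B1 where "B1 = {v \<in> B. s \<otimes> v \<in> reps I}"
    have D_swap: "D v = 0" if "v \<in> B - B1" for v
    proof -
      have v: "v \<in> reps I" "s \<otimes> v \<notin> reps I" using that by (auto simp: B_def B1_def)
      then obtain t where t: "t \<in> I" "s \<otimes> v = v \<otimes> t" using deodhar[OF I v(1) s] by blast
      have "F v (T s * h * T v) = F v (h * T v * T t)"
        using F_T_S_swap[OF s t(1) v(1) t(2), of "h * T v"] by (simp add: mult.assoc)
      then show ?thesis using T_S_rep_swap[OF s v(1) t] by (simp add: D_def mult.assoc)
    qed
    have D_pair': "D v + D (s \<otimes> v) = 0"
      if v: "v \<in> reps I" "s \<otimes> v \<in> reps I" and up: "\<ell> v < \<ell> (s \<otimes> v)" for v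
    proof -
      have vc: "v \<in> carrier W" using v repsD(1) by auto
      let ?v = "s \<otimes> v"
      have T: "T s * T v = T ?v" "T s * T ?v = scale (qpow 1) (T v) + scale (qpow 1 - 1) (T ?v)"
        using T_S_up[OF s vc] T_S_down[OF s, of ?v] up s vc by auto
      have "F v (T s * h * T v) = qpow 1 * F ?v (h * T v)"
        "F ?v (T s * h * T ?v) = F v (h * T ?v) + (qpow 1 - 1) * F ?v (h * T ?v)"
        using F_T_S_pair[OF s v up] by (simp_all add: mult.assoc)
      moreover have "F v (h * T s * T v) = F v (h * T ?v)"
        "F ?v (h * T s * T ?v) = qpow 1 * F ?v (h * T v) + (qpow 1 - 1) * F ?v (h * T ?v)"
        by (simp_all add: mult.assoc T distrib_left scale_mult_right linearD[OF F_linear])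
      ultimately have "D v + D ?v = qpow 1 * F ?v (h * T v) - F v (h * T ?v) +
          (F v (h * T ?v) + (qpow 1 - 1) * F ?v (h * T ?v) -
           (qpow 1 * F ?v (h * T v) + (qpow 1 - 1) * F ?v (h * T ?v)))"
        by (simp only: D_def)
      then show ?thesis by simp
    qed
    have D_pair: "D v + D (s \<otimes> v) = 0" if "v \<in> B1" for v
    proof -
      have v: "v \<in> reps I" "v \<in> carrier W" "s \<otimes> v \<in> reps I"
        using that cB by (auto simp: B_def B1_def)
      from v(2) s show ?thesis
      proof (cases rule: left_less_cases)
        case up
        then show ?thesis using D_pair'[OF v(1,3)] by simp
      next
        case down
        then show ?thesis using D_pair'[OF v(3)] v s by (simp add: add.commute)
      qed
    qed
    have img: "(\<lambda>v. s \<otimes> v) ` B1 \<subseteq> B1" using s cB by (auto simp: B1_def B_def)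
    have inj: "inj_on (\<lambda>v. s \<otimes> v) B1" using s cB by (intro inj_onI) (auto simp: B1_def)
    have "finite B1" using fin by (simp add: B1_def)
    then have "(\<lambda>v. s \<otimes> v) ` B1 = B1" using endo_inj_surj[OF _ img inj] by blast
    then have "sum D B1 = (\<Sum>v\<in>B1. D (s \<otimes> v))" using sum.reindex[OF inj, of D] by simp
    \<comment> \<open>Reindexing by the involution counts each pair twice. The factor 2 is then
      cancelled coefficientwise in the integers.\<close>
    then have "sum D B1 + sum D B1 = (\<Sum>v\<in>B1. D v + D (s \<otimes> v))" by (simp add: sum.distrib)
    also have "\<dots> = 0" using D_pair by simp
    finally have "sum D B1 + sum D B1 = 0" .
    then have "Poly_Mapping.lookup (sum D B1) k + Poly_Mapping.lookup (sum D B1) k = 0" for k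
      by (simp only: lookup_zero flip: lookup_add)
    then have "sum D B1 = 0" by (intro poly_mapping_eqI) (simp only: lookup_zero double_zero)
    moreover have "sum D B = sum D B1"
      using fin D_swap by (intro sum.mono_neutral_right) (auto simp: B1_def)
    ultimately show ?thesis by simp
  qed
  finally show ?thesis by simp
qed

lemma Ind_commute: "Ind (x * y) = Ind (y * x)"
proof -
  have word: "Ind (T (\<pi> xs) * y) = Ind (y * T (\<pi> xs))" if "reduced xs" for xs y
    using that
  proof (induction xs arbitrary: y)
    case (Cons s xs)
    note d = reduced_ConsD[OF Cons.prems]
    have T: "T (\<pi> (s # xs)) = T s * T (\<pi> xs)" using T_S_up[OF d(2,3)] d(4) by simp
    have "Ind (T (\<pi> (s # xs)) * y) = Ind (T (\<pi> xs) * y * T s)"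
      using Ind_T_S_commute[OF d(2), of "T (\<pi> xs) * y"] by (simp add: T mult.assoc del: word_Cons)
    also have "\<dots> = Ind (y * T s * T (\<pi> xs))"
      using Cons.IH[OF d(1), of "y * T s"] by (simp add: mult.assoc)
    finally show ?case by (simp add: T mult.assoc del: word_Cons)
  qed simp
  have "Ind (T w * y) = Ind (y * T w)" if "w \<in> carrier W" for w
    using word ex_reduced[OF that] by metis
  then show ?thesis
    by (rule linear_eqI[OF linear_comp_mult(2)[OF Ind_linear, of y]
          linear_comp_mult(1)[OF Ind_linear, of y], of x])
qed

lemma Ind_commutator:
  assumes "h \<in> commutator_span scale UNIV"
  shows "Ind h = 0"
proof -
  have "Ind h = (\<lambda>_. 0) h"
  proof (rule linear_eq_on_span[OF Ind_linear])
    show "h \<in> H.span {x * y - y * x |x y. x \<in> UNIV \<and> y \<in> UNIV}"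
      using assms by (simp add: commutator_span_def)
    show "Ind z = 0" if z: "z \<in> {x * y - y * x |x y. x \<in> UNIV \<and> y \<in> UNIV}" for z
    proof -
      obtain x y where "z = x * y - y * x" using z by blast
      then show ?thesis using linearD(4)[OF Ind_linear] Ind_commute[of x y] by simp
    qed
  qed (simp add: laurent_linear_def)
  then show ?thesis by simp
qed

text \<open>By \<open>reps_conj_generate_eq_one\<close>, only the identity coset contributes at
  \<open>T w\<close> with w in W_I, and its contribution is \<open>f (T w)\<close>.\<close>

lemma Ind_parabolic:
  assumes N: "\<And>K. \<lbrakk>K \<subseteq> S; conj_under W (carrier W) J K\<rbrakk> \<Longrightarrow>
      normalizer W (generate W K) \<subseteq> generate W I"
    and h: "h \<in> HP I"
  shows "Ind h = f h"
proof (rule f_eq_linear[OF Ind_linear _ h])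
  fix w assume w: "w \<in> WI"
  have "v = \<one>" if "(v, y) \<in> supp (T w)" for v y
  proof -
    note vy = supp_T[OF I w that]
    show ?thesis
      by (rule reps_conj_generate_eq_one[OF I J f_support, OF _ vy(1,2,3,4)]) (rule N)
  qed
  then have "fst ` supp (T w) \<subseteq> {\<one>}" by auto
  then have "Ind (T w) = (\<Sum>v\<in>{\<one>}. F v (T w * T v))"
    using I by (intro Ind_eq_sum) auto
  also have "\<dots> = f (T w)" using F_T_mult[of \<one> \<one> w] I w by simp
  finally show "Ind (T w) = f (T w)" .
qed

text \<open>By \<open>reps_conj_parabolic\<close>, a non-zero term would yield a conjugate of
  \<open>J\<close> inside \<open>K\<close>.\<close>

lemma Ind_T_eq_0:
  assumes K: "K \<subseteq> S" "\<not> (\<exists>K'\<subseteq>K. conj_under W (carrier W) J K')" and w: "w \<in> generate W K"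
  shows "Ind (T w) = 0"
proof -
  have "(v, y) \<notin> supp (T w)" for v y
  proof
    assume "(v, y) \<in> supp (T w)"
    note vy = supp_T[OF K(1) w this]
    obtain a b J' where "a \<in> generate W K" and b: "b \<in> double_reps K I" and "v = a \<otimes> b"
      and J': "J' \<subseteq> I" "conj_under W (generate W I) J J'" "cj b ` J' \<subseteq> K"
      by (rule reps_conj_parabolic[OF I K(1) J f_support, OF vy(1,2,3,4)])
    have "b \<in> carrier W" using b repsD(1) by (auto simp: double_reps_def)
    then have "conj_under W (carrier W) J (cj b ` J')"
      using conj_under_trans[OF I _ J'(2)] J I by blast
    then show False using K(2) J'(3) by blast
  qed
  then have "supp (T w) = {}" by auto
  then show ?thesis by (simp add: ind_def)
qed

section \<open>Reduction modulo q - 1\<close>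

lemma coef_mod:
  assumes "w \<in> carrier W" "v \<in> carrier W" "y \<in> carrier W"
  shows "qpow 1 - 1 dvd coef y (T w * T v) - (if w \<otimes> v = y then 1 else 0)"
proof -
  obtain h where "T w * T v = T (w \<otimes> v) + scale (qpow 1 - 1) h"
    using T_mult_mod[OF subset_refl, of w v] assms generated by auto
  then have "coef y (T w * T v) = (if w \<otimes> v = y then 1 else 0) + (qpow 1 - 1) * coef y h"
    using assms by (simp only: linearD[OF coef_linear] coef_T m_closed)
  then show ?thesis by simp
qed

text \<open>Multiplying \<open>T (g \<otimes> y)\<close> and \<open>T (inv g)\<close> in the two
  orders gives, modulo q - 1, the basis elements at g y g^-1 and at y. The trace property equates
  the values of \<open>f\<close> on the two products.\<close>

lemma f_conj_mod:
  assumes g: "g \<in> WI" and y: "y \<in> WI"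
  shows "qpow 1 - 1 dvd f (T (cj g y)) - f (T y)"
proof -
  have gy: "g \<otimes> y \<in> WI" "inv g \<in> WI" using g y I by simp_all
  obtain h where h: "h \<in> HP I" "T (g \<otimes> y) * T (inv g) = T (cj g y) + scale (qpow 1 - 1) h"
    using T_mult_mod[OF I gy] by blast
  obtain h' where h': "h' \<in> HP I" "T (inv g) * T (g \<otimes> y) = T y + scale (qpow 1 - 1) h'"
    using T_mult_mod[OF I gy(2,1)] g y by auto
  have "f (T (g \<otimes> y) * T (inv g)) = f (T (inv g) * T (g \<otimes> y))"
    using f_trace gy by simp
  moreover have "cj g y \<in> WI" using g y I by simp
  ultimately have "f (T (cj g y)) + (qpow 1 - 1) * f h = f (T y) + (qpow 1 - 1) * f h'"
    using h h' y by (simp add: f_add f_scale)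
  then have "f (T (cj g y)) - f (T y) = (qpow 1 - 1) * (f h' - f h)"
    by (simp add: algebra_simps)
  then show ?thesis by simp
qed

text \<open>At q = 1 the coefficient in a term is 1 if w v = v y and 0 otherwise. So the form sums
  \<open>f\<close> over cosets fixed by \<open>w\<close>, and grouping these by the class of v^-1 w
  v gives the constants.\<close>

lemma Ind_mod:
  assumes C: "C \<in> conj_classes W (carrier W)" and w: "w \<in> C"
    and r: "\<And>C'. \<lbrakk>C' \<in> conj_classes W WI; C' \<subseteq> C\<rbrakk> \<Longrightarrow> r C' \<in> C'"
  shows "qpow 1 - 1 dvd Ind (T w) -
    (\<Sum>C' | C' \<in> conj_classes W WI \<and> C' \<subseteq> C. of_int (class_index I C') * f (T (r C')))"
proof -
  let ?p = "qpow 1 - 1 :: laurent"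
  let ?\<C> = "{C' \<in> conj_classes W WI. C' \<subseteq> C}"
  let ?x = "\<lambda>v. cj (inv v) w"
  note CD = conj_classD[OF subset_refl, of C, unfolded generated, OF C]
  note C'D = conj_classD[OF I]
  have wc: "w \<in> carrier W" using CD(1) w .
  \<comment> \<open>Fixed cosets whose term at \<open>T w\<close> is non-zero. This set is always
    finite, but it may omit fixed cosets; the last case distinction deals with that.\<close>
  define G where "G = {v \<in> reps I. ?x v \<in> WI \<and> (v, ?x v) \<in> supp (T w)}"
  define GC where "GC C' = {v \<in> G. cl I (?x v) = C'}" for C'
  have "G \<subseteq> fst ` supp (T w)" by (force simp: G_def)
  then have finG: "finite G" using fst_supp finite_subset by blast
  have \<C>: "finite ?\<C>" by (rule finite_subclasses[OF I C])

  have "?p dvd Ind (T w) - (\<Sum>v\<in>G. f (T (?x v)))"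
  proof -
    let ?e = "\<lambda>(v, y). if w \<otimes> v = v \<otimes> y then f (T y) else 0"
    have "?p dvd ind_term W S T \<tau> f (T w) v y - ?e (v, y)" if "(v, y) \<in> supp (T w)" for v y
    proof -
      have vy: "v \<in> reps I" "y \<in> WI" using that by (auto simp: supp_iff)
      have c: "v \<in> carrier W" "v \<otimes> y \<in> carrier W" using vy repsD(1) by auto
      have "ind_term W S T \<tau> f (T w) v y - ?e (v, y) =
          f (T y) * (coef (v \<otimes> y) (T w * T v) - (if w \<otimes> v = v \<otimes> y then 1 else 0))"
        by (simp add: ind_term_eq[OF vy] right_diff_distrib)
      then show ?thesis using coef_mod[OF wc c] by simp
    qed
    then have "?p dvd (\<Sum>vy\<in>supp (T w). (case vy of (v, y) \<Rightarrow> ind_term W S T \<tau> f (T w) v y) - ?e vy)"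
      by (intro dvd_sum) auto
    moreover have "(\<Sum>vy\<in>supp (T w). ?e vy) = (\<Sum>v\<in>G. f (T (?x v)))"
    proof -
      have "(\<Sum>vy\<in>supp (T w). ?e vy) = (\<Sum>vy\<in>(\<lambda>v. (v, ?x v)) ` G. ?e vy)"
      proof (rule sum.mono_neutral_right[OF finite_supp])
        show "(\<lambda>v. (v, ?x v)) ` G \<subseteq> supp (T w)" by (auto simp: G_def)
        show "\<forall>vy\<in>supp (T w) - (\<lambda>v. (v, ?x v)) ` G. ?e vy = 0"
        proof (clarify, rule ccontr)
          fix v y assume vy: "(v, y) \<in> supp (T w)" "(v, y) \<notin> (\<lambda>v. (v, ?x v)) ` G"
            and "(if w \<otimes> v = v \<otimes> y then f (T y) else 0) \<noteq> 0"
          then have eq: "w \<otimes> v = v \<otimes> y" by (auto split: if_splits)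
          have v: "v \<in> reps I" "y \<in> WI" using vy by (auto simp: supp_iff)
          then have c: "v \<in> carrier W" using repsD(1) by auto
          have "?x v = y" using c eq v(2) wc by (simp add: m_assoc)
          then have "v \<in> G" "(v, y) = (v, ?x v)" using v vy by (auto simp: G_def)
          then show False using vy(2) by blast
        qed
      qed
      also have "\<dots> = (\<Sum>v\<in>G. ?e (v, ?x v))"
        by (subst sum.reindex) (auto intro: inj_onI)
      also have "\<dots> = (\<Sum>v\<in>G. f (T (?x v)))"
        using repsD(1) wc by (intro sum.cong) (auto simp: G_def m_assoc)
      finally show ?thesis .
    qed
    ultimately show ?thesis by (simp add: ind_def sum_subtractf)
  qed
  moreover have "(\<Sum>v\<in>G. f (T (?x v))) = (\<Sum>C'\<in>?\<C>. \<Sum>v\<in>GC C'. f (T (?x v)))"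
    unfolding GC_def
  proof (rule sum.group[symmetric, OF finG \<C>], rule image_subsetI)
    fix v assume v: "v \<in> G"
    then have v': "?x v \<in> WI" "v \<in> carrier W" using repsD(1) by (auto simp: G_def)
    have "?x v \<in> C" using CD(3)[OF w, of "inv v"] v' by simp
    have "cl I (?x v) \<subseteq> C"
    proof
      fix z assume "z \<in> cl I (?x v)"
      then obtain g where "g \<in> WI" "z = cj g (?x v)" by (auto simp: cl_def)
      then show "z \<in> C" using CD(3)[OF \<open>?x v \<in> C\<close>, of g] by simp
    qed
    then show "cl I (?x v) \<in> ?\<C>" using cl_conj_class v' by blast
  qed
  moreover have "?p dvd (\<Sum>v\<in>GC C'. f (T (?x v))) - of_int (class_index I C') * f (T (r C'))"
    if C': "C' \<in> ?\<C>" for C'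
  proof -
    have C'I: "C' \<in> conj_classes W WI" "C' \<subseteq> C" using C' by auto
    have f_mod: "?p dvd f (T (?x v)) - f (T (r C'))" if xv: "?x v \<in> C'" for v
    proof -
      obtain g where g: "g \<in> WI" "?x v = cj g (r C')"
        using C'D(4)[OF C'I(1) r[OF C'I] xv] by blast
      show ?thesis unfolding g(2) using f_conj_mod[OF g(1) C'D(1)[OF C'I(1) r[OF C'I]]] .
    qed
    have GC_eq: "GC C' = {v \<in> G. ?x v \<in> C'}"
      using C'D(2)[OF C'I(1)] cl_self[OF I] by (auto simp: GC_def G_def)
    have "?p dvd (\<Sum>v\<in>GC C'. f (T (?x v)) - f (T (r C')))"
      using f_mod by (intro dvd_sum) (auto simp: GC_eq)
    then have sum_mod: "?p dvd (\<Sum>v\<in>GC C'. f (T (?x v))) - of_nat (card (GC C')) * f (T (r C'))"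
      by (simp add: sum_subtractf)
    show ?thesis
    \<comment> \<open>If no fixed coset is omitted, \<open>class_index\<close> is their number. An
      omitted one has term 0 although its coefficient is 1 modulo q - 1, so \<open>f\<close>
      vanishes modulo q - 1 on the class and any constant works.\<close>
    proof (cases "fixed_reps I C' w \<subseteq> G")
      case True
      then have "GC C' = fixed_reps I C' w" by (auto simp: GC_eq fixed_reps_def G_def)
      moreover have "finite (fixed_reps I C' w)" using True finG finite_subset by blast
      ultimately show ?thesis
        using sum_mod class_index_eq[OF I C'I(1) C C'I(2) w] by simp
    next
      case False
      then obtain v where v: "v \<in> reps I" "?x v \<in> C'" "v \<notin> G" by (auto simp: fixed_reps_def)
      have xv: "?x v \<in> WI" using C'D(1)[OF C'I(1) v(2)] .
      have c: "v \<in> carrier W" "?x v \<in> carrier W" "v \<otimes> ?x v \<in> carrier W"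
        using v(1) xv repsD(1) by auto
      have "(v, ?x v) \<notin> supp (T w)" using v xv by (auto simp: G_def)
      then have zero: "f (T (?x v)) * coef (v \<otimes> ?x v) (T w * T v) = 0"
        using v(1) xv by (simp add: supp_iff del: mult_eq_0_iff)
      have "w \<otimes> v = v \<otimes> ?x v" using c(1) wc by (simp add: m_assoc)
      then have "?p dvd f (T (?x v)) * (coef (v \<otimes> ?x v) (T w * T v) - 1)"
        using coef_mod[OF wc c(1,3)] by (intro dvd_mult) simp
      then have "?p dvd - f (T (?x v))" by (simp add: right_diff_distrib zero del: mult_eq_0_iff)
      then have "?p dvd f (T (?x v))" by simp
      then have "?p dvd f (T (?x v)) - (f (T (?x v)) - f (T (r C')))"
        using f_mod[OF v(2)] by (rule dvd_diff)
      then have "?p dvd f (T (r C'))" by simp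
      then have "?p dvd (of_nat (card (GC C')) - of_int (class_index I C')) * f (T (r C'))"
        by (rule dvd_mult)
      from dvd_add[OF sum_mod this] show ?thesis by (simp add: left_diff_distrib)
    qed
  qed
  then have "?p dvd (\<Sum>C'\<in>?\<C>.
      (\<Sum>v\<in>GC C'. f (T (?x v))) - of_int (class_index I C') * f (T (r C')))"
    by (rule dvd_sum)
  ultimately have "?p dvd (Ind (T w) - (\<Sum>v\<in>G. f (T (?x v)))) +
      ((\<Sum>v\<in>G. f (T (?x v))) - (\<Sum>C'\<in>?\<C>. of_int (class_index I C') * f (T (r C'))))"
    by (intro dvd_add) (simp_all add: sum_subtractf)
  then show ?thesis by simp
qed

end

theorem theorem3p1:
  fixes W :: "('w, 'm) monoid_scheme"
    and S I :: "'w set"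
    and scale :: "laurent \<Rightarrow> 'h::ring_1 \<Rightarrow> 'h"
    and T :: "'w \<Rightarrow> 'h"
    and \<tau> :: "'h \<Rightarrow> laurent"
  assumes "hecke_algebra W S scale T"
    and "is_tau W scale T \<tau>"
    and "I \<subseteq> S"
  shows "\<exists>c :: 'w set \<Rightarrow> int. (\<forall>C'. c C' > 0) \<and>
    (\<forall>J f.
      J \<subseteq> I \<longrightarrow>
      normalizer W (generate W J) \<subseteq> generate W I \<longrightarrow>
      cocenter_form scale (parabolic_hecke W scale T I) f \<longrightarrow>
      (\<forall>J'\<subseteq>I. \<not> (\<exists>K\<subseteq>J'. conj_under W (generate W I) J K) \<longrightarrow>
         (\<forall>w\<in>generate W J'. f (T w) = 0)) \<longrightarrow>
      (\<forall>h. finite (ind_support W S T \<tau> I f h)) \<and>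
      (Modules.module_hom scale (*) (ind W S T \<tau> I f) \<and>
       (\<forall>h\<in>commutator_span scale UNIV. ind W S T \<tau> I f h = 0)) \<and>
      ((\<forall>K\<subseteq>S. conj_under W (carrier W) J K \<longrightarrow>
          normalizer W (generate W K) \<subseteq> generate W I) \<longrightarrow>
       (\<forall>h\<in>parabolic_hecke W scale T I. ind W S T \<tau> I f h = f h)) \<and>
      (\<forall>K\<subseteq>S. \<not> (\<exists>K'\<subseteq>K. conj_under W (carrier W) J K') \<longrightarrow>
         (\<forall>w\<in>generate W K. ind W S T \<tau> I f (T w) = 0)) \<and>
      (\<forall>C\<in>conj_classes W (carrier W).
         finite {C' \<in> conj_classes W (generate W I). C' \<subseteq> C} \<and>
         (\<forall>w\<in>min_length_elts W S C. \<forall>r.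
            (\<forall>C'\<in>conj_classes W (generate W I). C' \<subseteq> C \<longrightarrow> r C' \<in> min_length_elts W S C') \<longrightarrow>
            (qpow 1 - 1) dvd
              (ind W S T \<tau> I f (T w) -
               (\<Sum>C' | C' \<in> conj_classes W (generate W I) \<and> C' \<subseteq> C.
                  of_int (c C') * f (T (r C')))))))"
proof -
  interpret hecke_trace W S scale T \<tau>
    using assms(1,2) by (simp add: hecke_trace_def hecke_trace_axioms_def)
  show ?thesis
  \<comment> \<open>The witness depends only on \<open>I\<close> and the class, so the same
    constants serve every \<open>J\<close> and \<open>f\<close>.\<close>
  proof (rule exI[of _ "class_index I"], rule conjI, rule allI[OF class_index_pos],
      intro allI impI)
    fix J f
    assume J: "J \<subseteq> I" and N: "normalizer W (generate W J) \<subseteq> generate W I"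
      and form: "cocenter_form scale (parabolic_hecke W scale T I) f"
      and van: "\<forall>J'\<subseteq>I. \<not> (\<exists>K\<subseteq>J'. conj_under W (generate W I) J K) \<longrightarrow>
         (\<forall>w\<in>generate W J'. f (T w) = 0)"
    interpret hecke_induction W S scale T \<tau> I J f
      by unfold_locales (use assms(3) J N form van in blast)+
    show "(\<forall>h. finite (ind_support W S T \<tau> I f h)) \<and>
      (Modules.module_hom scale (*) (ind W S T \<tau> I f) \<and>
       (\<forall>h\<in>commutator_span scale UNIV. ind W S T \<tau> I f h = 0)) \<and>
      ((\<forall>K\<subseteq>S. conj_under W (carrier W) J K \<longrightarrow>
          normalizer W (generate W K) \<subseteq> generate W I) \<longrightarrow>
       (\<forall>h\<in>parabolic_hecke W scale T I. ind W S T \<tau> I f h = f h)) \<and>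
      (\<forall>K\<subseteq>S. \<not> (\<exists>K'\<subseteq>K. conj_under W (carrier W) J K') \<longrightarrow>
         (\<forall>w\<in>generate W K. ind W S T \<tau> I f (T w) = 0)) \<and>
      (\<forall>C\<in>conj_classes W (carrier W).
         finite {C' \<in> conj_classes W (generate W I). C' \<subseteq> C} \<and>
         (\<forall>w\<in>min_length_elts W S C. \<forall>r.
            (\<forall>C'\<in>conj_classes W (generate W I). C' \<subseteq> C \<longrightarrow> r C' \<in> min_length_elts W S C') \<longrightarrow>
            (qpow 1 - 1) dvd
              (ind W S T \<tau> I f (T w) -
               (\<Sum>C' | C' \<in> conj_classes W (generate W I) \<and> C' \<subseteq> C.
                  of_int (class_index I C') * f (T (r C'))))))"
    proof (intro conjI)
      show "\<forall>h. finite (supp h)" using finite_supp by blast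
      show "Modules.module_hom scale (*) Ind"
        using Ind_linear laurent_linear_iff[OF scale_module] by blast
      show "\<forall>h\<in>commutator_span scale UNIV. Ind h = 0" using Ind_commutator by blast
      show "(\<forall>K\<subseteq>S. conj_under W (carrier W) J K \<longrightarrow>
          normalizer W (generate W K) \<subseteq> generate W I) \<longrightarrow> (\<forall>h\<in>HP I. Ind h = f h)"
        using Ind_parabolic by blast
      show "\<forall>K\<subseteq>S. \<not> (\<exists>K'\<subseteq>K. conj_under W (carrier W) J K') \<longrightarrow>
         (\<forall>w\<in>generate W K. Ind (T w) = 0)"
        using Ind_T_eq_0 by blast
    qed (intro ballI conjI allI impI finite_subclasses[OF assms(3)] Ind_mod;
        auto simp: min_length_elts_def)
  qed
qed

end
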